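(* Let $K$ be a field and let $E$ and $F$ be polycephaly graphs. Then $\mathcal{L}_K(E)\cong_{\mathrm{gr}}\mathcal{L}_K(F)$ as rings if and only if $\mathcal{L}_K(E)\cong_{\mathrm{gr}}\mathcal{L}_K(F)$ as $K$-algebras.
   Context: Graphs. A directed graph $E=(E^0,E^1,r,s)$ has vertex set $E^0$, edge set $E^1$, range and source maps $r,s$; it is finite if $E^0,E^1$ are finite. A vertex $v$ is a sink if $s^{-1}(v)=\emptyset$. A path is a sequence of edges $\mu_1\cdots\mu_k$ with $r(\mu_i)=s(\mu_{i+1})$; vertices are paths of length $0$. A cycle is a closed path $\mu_1\cdots\mu_k$ ($k\ge 1$) with $s(\mu_i)\ne s(\mu_j)$ for $i\neq j$. A finite graph is acyclic if it has no cycles. A finite graph is a $C_n$-comet if it has exactly one cycle $C$, $C$ has length $n$, and every vertex is connected by a directed path to a vertex of $C$. A rose with $k$ petals $L_k$ ($k\ge 0$) is a graph with one vertex and $k$ loops. A cycle or rose has no exit if no edge outside it starts at one of its vertices. Polycephaly graph: a finite (connected) graph $E$ consisting of $C_{l_s}$-comets, $1\le s\le h$, and a finite acyclic graph with sinks $\{v_{h+1},\dots,v_t\}$ together with roses $L_{n_s}$ with $n_s$ petals attached to $v_s$ ($n_s\ge 0$ an integer, $h+1\le s\le t$), such that all the cycles and roses are mutually disjoint, every vertex of $E$ is connected by a directed path to at least one of the $v_s$, $h+1\le s\le t$, or to at least one cycle, and no cycle or rose has an exit. ($h=0$: no cycles; $t=h$: no roses.) Leavitt path algebra. $\mathcal{L}_K(E)$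 is the $K$-algebra generated by $\{v\mid v\in E^0\}$, $\{\alpha\mid\alpha\in E^1\}$, $\{\alpha^*\mid\alpha\in E^1\}$ subject to: $v_iv_j=\delta_{ij}v_i$; $s(\alpha)\alpha=\alpha r(\alpha)=\alpha$ and $r(\alpha)\alpha^*=\alpha^*s(\alpha)=\alpha^*$; $\alpha^*\alpha'=\delta_{\alpha\alpha'}r(\alpha)$; $\sum_{s(\alpha)=v}\alpha\alpha^*=v$ whenever $s^{-1}(v)\neq\emptyset$ (finite). It is $\mathbb{Z}$-graded by $\deg v=0$, $\deg\alpha=1$, $\deg\alpha^*=-1$. $\cong_{\mathrm{gr}}$ denotes degree-preserving isomorphism (of rings, respectively of $K$-algebras). *)

theory Defs
  imports
    "Graph_Theory.Graph_Theory"
    "HOL-Library.Poly_Mapping"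
    "HOL-Algebra.Module"
    "HOL-Algebra.QuotRing"
begin

section \<open>Polycephaly graphs\<close>

text \<open>
  A directed graph \<open>(E\<^sup>0, E\<^sup>1, r, s)\<close> is a \<open>wf_digraph\<close> with \<open>E\<^sup>0 = verts E\<close>, \<open>E\<^sup>1 = arcs E\<close>,
  \<open>s = tail E\<close> and \<open>r = head E\<close>; loops and parallel edges are allowed.
  Cycles are \<open>pre_digraph.cycle\<close>. They are lists of edges and hence carry a base point; in
  statements such as ``exactly one cycle'' they are identified up to rotation.
\<close>

definition sinks :: "('v, 'e) pre_digraph \<Rightarrow> 'v set" where
  "sinks G = {v \<in> verts G. out_arcs G v = {}}"

definition acyclic_digraph :: "('v, 'e) pre_digraph \<Rightarrow> bool" where
  "acyclic_digraph G \<longleftrightarrow> fin_digraph G \<and> \<not> (\<exists>p. pre_digraph.cycle G p)"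

definition cycle_verts :: "('v, 'e) pre_digraph \<Rightarrow> 'e list \<Rightarrow> 'v set" where
  "cycle_verts G p = tail G ` set p"

definition comet :: "nat \<Rightarrow> ('v, 'e) pre_digraph \<Rightarrow> bool" where
  "comet n G \<longleftrightarrow> fin_digraph G \<and>
     (\<exists>p. pre_digraph.cycle G p \<and> length p = n \<and>
          (\<forall>q. pre_digraph.cycle G q \<longrightarrow> (\<exists>k. q = rotate k p)) \<and>
          (\<forall>v \<in> verts G. \<exists>w \<in> cycle_verts G p. v \<rightarrow>\<^sup>*\<^bsub>G\<^esub> w))"

definition rose :: "nat \<Rightarrow> ('v, 'e) pre_digraph \<Rightarrow> bool" where
  "rose k G \<longleftrightarrow> fin_digraph G \<and> card (verts G) = 1 \<and> card (arcs G) = k"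

text \<open>A cycle or rose with vertex set \<open>W\<close> and edge set \<open>B\<close> has no exit in \<open>G\<close>.\<close>

definition no_exit :: "('v, 'e) pre_digraph \<Rightarrow> 'v set \<Rightarrow> 'e set \<Rightarrow> bool" where
  "no_exit G W B \<longleftrightarrow> (\<forall>e \<in> arcs G. tail G e \<in> W \<longrightarrow> e \<in> B)"

text \<open>
  Below, \<open>D s\<close> is the \<open>s\<close>-th comet and \<open>c s\<close> its cycle (\<open>1 \<le> s \<le> h\<close>), \<open>A\<close> is the acyclic graph
  with sinks \<open>v s\<close>, and \<open>R s\<close> is the rose attached to \<open>v s\<close> (\<open>h < s \<le> t\<close>). The comets and the
  acyclic graph may overlap away from the cycles and roses. Since such an overlap could create
  further cycles, the condition in the middle says that every cycle of \<open>E\<close> is one of the \<open>c s\<close>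
  or lies in a rose. Hence ``all the cycles'' in the last group of conditions are the \<open>c s\<close>.
\<close>

definition polycephaly_graph :: "('v, 'e) pre_digraph \<Rightarrow> bool" where
  "polycephaly_graph E \<longleftrightarrow> fin_digraph E \<and> Digraph_Component.connected E \<and>
    (\<exists>(h::nat) (t::nat) D l c A v R n.
      h \<le> t \<and>
      (\<forall>s \<in> {1..h}. subgraph (D s) E \<and> comet (l s) (D s) \<and> pre_digraph.cycle (D s) (c s)) \<and>
      subgraph A E \<and> acyclic_digraph A \<and> bij_betw v {h+1..t} (sinks A) \<and>
      (\<forall>s \<in> {h+1..t}. subgraph (R s) E \<and> rose (n s) (R s) \<and> verts (R s) = {v s}) \<and>
      verts E = (\<Union>s\<in>{1..h}. verts (D s)) \<union> verts A \<union> (\<Union>s\<in>{h+1..t}. verts (R s)) \<and>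
      arcs E = (\<Union>s\<in>{1..h}. arcs (D s)) \<union> arcs A \<union> (\<Union>s\<in>{h+1..t}. arcs (R s)) \<and>

      (\<forall>p. pre_digraph.cycle E p \<longrightarrow>
         (\<exists>s \<in> {1..h}. \<exists>k. p = rotate k (c s)) \<or> (\<exists>s \<in> {h+1..t}. pre_digraph.cycle (R s) p)) \<and>

      disjoint_family_on (\<lambda>s. if s \<le> h then cycle_verts E (c s) else verts (R s)) {1..t} \<and>
      (\<forall>u \<in> verts E. (\<exists>s \<in> {h+1..t}. u \<rightarrow>\<^sup>*\<^bsub>E\<^esub> v s) \<or>
         (\<exists>s \<in> {1..h}. \<exists>w \<in> cycle_verts E (c s). u \<rightarrow>\<^sup>*\<^bsub>E\<^esub> w)) \<and>
      (\<forall>s \<in> {1..h}. no_exit E (cycle_verts E (c s)) (set (c s))) \<and>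
      (\<forall>s \<in> {h+1..t}. no_exit E (verts (R s)) (arcs (R s))))"


section \<open>Graded algebras\<close>

text \<open>
  \<open>homogeneous A n\<close> is the homogeneous component of degree \<open>n\<close>. The scalars are a whole type
  \<open>'k\<close>.
\<close>

record ('k, 'a) graded_algebra = "('k, 'a) module" +
  homogeneous :: "int \<Rightarrow> 'a set"

definition graded_ring_iso ::
  "('k, 'a) graded_algebra \<Rightarrow> ('k, 'b) graded_algebra \<Rightarrow> ('a \<Rightarrow> 'b) set" where
  "graded_ring_iso A B =
     {\<phi> \<in> ring_iso A B. \<forall>n. \<phi> ` homogeneous A n \<subseteq> homogeneous B n}"

definition graded_algebra_iso ::
  "('k, 'a) graded_algebra \<Rightarrow> ('k, 'b) graded_algebra \<Rightarrow> ('a \<Rightarrow> 'b) set" where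
  "graded_algebra_iso A B =
     {\<phi> \<in> graded_ring_iso A B. \<forall>c. \<forall>x \<in> carrier A. \<phi> (c \<odot>\<^bsub>A\<^esub> x) = c \<odot>\<^bsub>B\<^esub> \<phi> x}"

definition graded_ring_isomorphic ::
  "('k, 'a) graded_algebra \<Rightarrow> ('k, 'b) graded_algebra \<Rightarrow> bool" where
  "graded_ring_isomorphic A B \<longleftrightarrow> graded_ring_iso A B \<noteq> {}"

definition graded_algebra_isomorphic ::
  "('k, 'a) graded_algebra \<Rightarrow> ('k, 'b) graded_algebra \<Rightarrow> bool" where
  "graded_algebra_isomorphic A B \<longleftrightarrow> graded_algebra_iso A B \<noteq> {}"


section \<open>Leavitt path algebras\<close>

text \<open>
  Words under concatenation are the free monoid, so that \<open>'x list \<Rightarrow>\<^sub>0 'k\<close>, whose multiplication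
  is convolution, is the free unital associative \<open>'k\<close>-algebra on \<open>'x\<close>.
\<close>

instantiation list :: (type) monoid_add
begin

definition zero_list :: "'a list" where "zero_list = []"

definition plus_list :: "'a list \<Rightarrow> 'a list \<Rightarrow> 'a list" where "plus_list = append"

instance by standard (simp_all add: zero_list_def plus_list_def)

end

definition free_algebra :: "'x set \<Rightarrow> ('x list \<Rightarrow>\<^sub>0 'k::field) ring" where
  "free_algebra X =
     \<lparr>carrier = {f. Poly_Mapping.keys f \<subseteq> lists X}, mult = (*), one = 1, zero = 0, add = (+)\<rparr>"

datatype ('v, 'e) generator = Vertex 'v | Edge 'e | Ghost 'e

definition generators :: "('v, 'e) pre_digraph \<Rightarrow> ('v, 'e) generator set" where
  "generators E = Vertex ` verts E \<union> Edge ` arcs E \<union> Ghost ` arcs E"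

abbreviation var :: "'x \<Rightarrow> 'x list \<Rightarrow>\<^sub>0 'k::field" where
  "var x \<equiv> Poly_Mapping.single [x] 1"

text \<open>Each relation \<open>a = b\<close> is recorded as the element \<open>a - b\<close>.\<close>

definition leavitt_relators ::
  "('v, 'e) pre_digraph \<Rightarrow> (('v, 'e) generator list \<Rightarrow>\<^sub>0 'k::field) set" where
  "leavitt_relators E =
     {var (Vertex u) * var (Vertex w) - (if u = w then var (Vertex u) else 0) | u w.
        u \<in> verts E \<and> w \<in> verts E} \<union>
     {var (Vertex (tail E e)) * var (Edge e) - var (Edge e) | e. e \<in> arcs E} \<union>
     {var (Edge e) * var (Vertex (head E e)) - var (Edge e) | e. e \<in> arcs E} \<union>
     {var (Vertex (head E e)) * var (Ghost e) - var (Ghost e) | e. e \<in> arcs E} \<union>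
     {var (Ghost e) * var (Vertex (tail E e)) - var (Ghost e) | e. e \<in> arcs E} \<union>
     {var (Ghost e) * var (Edge f) - (if e = f then var (Vertex (head E e)) else 0) | e f.
        e \<in> arcs E \<and> f \<in> arcs E} \<union>
     {(\<Sum>e\<in>out_arcs E v. var (Edge e) * var (Ghost e)) - var (Vertex v) | v.
        v \<in> verts E \<and> out_arcs E v \<noteq> {} \<and> finite (out_arcs E v)}"

primrec generator_degree :: "('v, 'e) generator \<Rightarrow> int" where
  "generator_degree (Vertex v) = 0"
| "generator_degree (Edge e) = 1"
| "generator_degree (Ghost e) = -1"

definition word_degree :: "('v, 'e) generator list \<Rightarrow> int" where
  "word_degree w = (\<Sum>x\<leftarrow>w. generator_degree x)"

text \<open>
  The presentation is to be read in not necessarily unital algebras: with a unit adjoined freely,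
  \<open>1 - (\<Sum>v\<in>verts E. v)\<close> would survive as an additional central idempotent. Hence the carrier
  consists of the classes of polynomials without constant term. All relators lie in this
  non-unital free algebra \<open>P\<close>, and as \<open>P\<close> is an ideal with complement \<open>'k\<close> in the unital
  free algebra \<open>F\<close>, the ideal of \<open>F\<close> generated by the relators is also the algebra ideal of \<open>P\<close>
  they generate. For finite \<open>E\<close> the unit of \<open>P / I\<close> is the sum of the vertices.
  A scalar \<open>a\<close> acts as multiplication by the class of the constant polynomial \<open>a\<close>.
\<close>

definition leavitt_path_algebra ::
  "'k::field itself \<Rightarrow> ('v, 'e) pre_digraph \<Rightarrow>
     ('k, (('v, 'e) generator list \<Rightarrow>\<^sub>0 'k) set) graded_algebra" where
  "leavitt_path_algebra K E =
    (let F = free_algebra (generators E);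
         I = Idl\<^bsub>F\<^esub> (leavitt_relators E);
         P = {f \<in> carrier F. Poly_Mapping.lookup f [] = 0}
     in \<lparr>carrier = (\<lambda>f. I +>\<^bsub>F\<^esub> f) ` P,
         mult = mult (F Quot I),
         one = I +>\<^bsub>F\<^esub> (\<Sum>v\<in>verts E. var (Vertex v)),
         zero = zero (F Quot I),
         add = add (F Quot I),
         smult = (\<lambda>a x. (I +>\<^bsub>F\<^esub> Poly_Mapping.single [] a) \<otimes>\<^bsub>F Quot I\<^esub> x),
         homogeneous = (\<lambda>n. (\<lambda>f. I +>\<^bsub>F\<^esub> f) `
           {f \<in> P. \<forall>w \<in> Poly_Mapping.keys f. word_degree w = n})\<rparr>)"

end

theory Submission
  imports Defs
begin

text \<open>
  Let \<open>L = L\<^sub>K(E)\<close> for a finite graph \<open>E\<close>, and let \<open>Z\<^sub>0\<close> be the part of degree zero of the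
  centre of \<open>L\<close>. The proof rests on one structural fact: \<open>Z\<^sub>0\<close> is a finite product of copies of
  \<open>K\<close>, spanned by orthogonal idempotents \<open>e\<^sub>C\<close> with sum \<open>1\<close> that are integer combinations of
  products of generators. Integrality matters because every field automorphism \<open>\<sigma>\<close> of \<open>K\<close>
  acts on \<open>L\<close> by twisting coefficients, and this twist then fixes each \<open>e\<^sub>C\<close>.

  Given this, let \<open>\<phi>\<close> be a graded ring isomorphism from \<open>L\<close> to another such algebra \<open>M\<close> with
  idempotents \<open>f\<^sub>D\<close>. It maps \<open>Z\<^sub>0(L)\<close> onto \<open>Z\<^sub>0(M)\<close>, so that \<open>\<phi>(c 1) f\<^sub>D = \<sigma>\<^sub>D(c) f\<^sub>D\<close> for a
  map \<open>\<sigma>\<^sub>D\<close>, and \<open>\<sigma>\<^sub>D\<close> is a field automorphism. In other words \<open>\<phi>\<close> is semilinear on every block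
  \<open>f\<^sub>D M\<close>, though possibly for different automorphisms on different blocks. Following \<open>\<phi>\<close> on
  \<open>f\<^sub>D M\<close> by the coefficient twist with the inverse of \<open>\<sigma>\<^sub>D\<close> gives a graded isomorphism of
  \<open>K\<close>-algebras; this is the lemma \<open>graded_ring_isomorphic_imp_algebra\<close>.

  To find \<open>Z\<^sub>0\<close>, call a vertex persistent if it is a sink or the end of arbitrarily long
  paths. In a polycephaly graph these are the sinks and the vertices of the cycles and of the
  roses with petals. A central \<open>z\<close> of degree zero satisfies \<open>z v = k v\<close> with a scalar \<open>k\<close> at every persistent vertex \<open>v\<close> (\<open>central_scalar_at_persistent\<close>), and the scalar is
  the same at both ends of an edge that starts at a persistent vertex
  (\<open>central_scalar_on_block\<close>). The remaining vertices lead to persistent ones in boundedly many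
  steps, so a central element that vanishes on all persistent vertices is zero
  (\<open>central_eq_zero\<close>), and every class \<open>C\<close> of linked persistent vertices is cut out by a
  central idempotent \<open>e\<^sub>C\<close> (\<open>block_idempotent_exists\<close>).
\<close>

(* Below, this symbol is addition in a ring. *)
no_notation vwalk_join (infixr \<open>\<oplus>\<close> 65)

section \<open>From ring isomorphisms to algebra isomorphisms\<close>

locale field_automorphism =
  fixes \<sigma> :: "'k::field \<Rightarrow> 'k"
  assumes bij: "bij \<sigma>"
    and one: "\<sigma> 1 = 1"
    and add: "\<sigma> (c + d) = \<sigma> c + \<sigma> d"
    and mult: "\<sigma> (c * d) = \<sigma> c * \<sigma> d"
begin

lemma zero: "\<sigma> 0 = 0"
  using add[of 0 0] by (metis add_cancel_right_right)

lemma inverse_automorphism: "field_automorphism (inv_into UNIV \<sigma>)"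
proof
  have inj: "inj \<sigma>" and surj: "surj \<sigma>" using bij by (auto simp: bij_def)
  note f_inv = surj_f_inv_f[OF surj]
  show "bij (inv_into UNIV \<sigma>)" using bij by (rule bij_imp_bij_inv)
  show "inv_into UNIV \<sigma> 1 = 1" using one inj by (metis inv_f_f)
  show "inv_into UNIV \<sigma> (c + d) = inv_into UNIV \<sigma> c + inv_into UNIV \<sigma> d" for c d
    using inj by (rule inv_f_eq) (simp add: add f_inv)
  show "inv_into UNIV \<sigma> (c * d) = inv_into UNIV \<sigma> c * inv_into UNIV \<sigma> d" for c d
    using inj by (rule inv_f_eq) (simp add: mult f_inv)
qed

end

definition degree_zero_center :: "('k, 'a) graded_algebra \<Rightarrow> 'a set" where
  "degree_zero_center A =
     {z \<in> homogeneous A 0. \<forall>x \<in> carrier A. z \<otimes>\<^bsub>A\<^esub> x = x \<otimes>\<^bsub>A\<^esub> z}"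

text \<open>
  The idempotents \<open>e s\<close> split the degree-zero centre: by \<open>separation\<close> and \<open>assembly\<close> the
  algebra is the product of its blocks \<open>e s A\<close>, and by \<open>center_spanned\<close> the degree-zero centre
  acts on each block by scalars. Phrasing this through elements with prescribed components
  avoids finite sums in the carrier. Scalars enter only through the central elements
  \<open>c \<odot> \<one>\<close>. The map \<open>deg0_part\<close> is the projection onto degree zero; its existence expresses that
  the homogeneous components are independent, and \<open>homogeneous_induct\<close> that they span.
\<close>

locale split_graded_algebra = ring A
  for A :: "('k::field, 'a) graded_algebra" (structure) +
  fixes S :: "'i set" and e :: "'i \<Rightarrow> 'a" and deg0_part :: "'a \<Rightarrow> 'a"
  assumes homogeneous_carrier: "homogeneous A n \<subseteq> carrier A"
    and homogeneous_times: "\<lbrakk>x \<in> homogeneous A 0; y \<in> homogeneous A n\<rbrakk> \<Longrightarrow> x \<otimes> y \<in> homogeneous A n"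
    and smult_scalar: "x \<in> carrier A \<Longrightarrow> c \<odot> x = (c \<odot> \<one>) \<otimes> x"
    and scalar_central: "c \<odot> \<one> \<in> degree_zero_center A"
    and scalar_one: "1 \<odot> \<one> = \<one>"
    and scalar_add: "(c + d) \<odot> \<one> = c \<odot> \<one> \<oplus> d \<odot> \<one>"
    and scalar_mult: "(c * d) \<odot> \<one> = (c \<odot> \<one>) \<otimes> (d \<odot> \<one>)"
    and deg0_part_closed: "x \<in> carrier A \<Longrightarrow> deg0_part x \<in> homogeneous A 0"
    and deg0_part_add: "\<lbrakk>x \<in> carrier A; y \<in> carrier A\<rbrakk> \<Longrightarrow>
          deg0_part (x \<oplus> y) = deg0_part x \<oplus> deg0_part y"
    and deg0_part_homogeneous: "x \<in> homogeneous A n \<Longrightarrow> deg0_part x = (if n = 0 then x else \<zero>)"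
    and homogeneous_induct: "\<lbrakk>x \<in> carrier A; \<And>n x. x \<in> homogeneous A n \<Longrightarrow> Q x;
          \<And>x y. \<lbrakk>x \<in> carrier A; y \<in> carrier A; Q x; Q y\<rbrakk> \<Longrightarrow> Q (x \<oplus> y)\<rbrakk> \<Longrightarrow> Q x"
    and idempotent_central: "s \<in> S \<Longrightarrow> e s \<in> degree_zero_center A"
    and idempotent_nonzero: "s \<in> S \<Longrightarrow> e s \<noteq> \<zero>"
    and idempotent: "s \<in> S \<Longrightarrow> e s \<otimes> e s = e s"
    and separation: "\<lbrakk>x \<in> carrier A; \<And>s. s \<in> S \<Longrightarrow> e s \<otimes> x = \<zero>\<rbrakk> \<Longrightarrow> x = \<zero>"
    and assembly: "(\<And>s. s \<in> S \<Longrightarrow> g s \<in> carrier A) \<Longrightarrow>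
          \<exists>y \<in> carrier A. (\<forall>s \<in> S. e s \<otimes> y = e s \<otimes> g s) \<and>
            (\<forall>n. (\<forall>s \<in> S. g s \<in> homogeneous A n) \<longrightarrow> y \<in> homogeneous A n)"
    and center_spanned: "\<lbrakk>z \<in> degree_zero_center A; s \<in> S\<rbrakk> \<Longrightarrow> \<exists>k. z \<otimes> e s = k \<odot> e s"
    and coefficient_twist: "field_automorphism \<sigma>
          \<Longrightarrow> \<exists>T \<in> graded_ring_iso A A. (\<forall>c. T (c \<odot> \<one>) = \<sigma> c \<odot> \<one>) \<and> (\<forall>s \<in> S. T (e s) = e s)"
begin

lemma degree_zero_center_carrier: "z \<in> degree_zero_center A \<Longrightarrow> z \<in> carrier A"
  using homogeneous_carrier by (auto simp: degree_zero_center_def)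

lemma degree_zero_center_commute:
  "\<lbrakk>z \<in> degree_zero_center A; x \<in> carrier A\<rbrakk> \<Longrightarrow> z \<otimes> x = x \<otimes> z"
  by (auto simp: degree_zero_center_def)

lemma degree_zero_center_times:
  assumes "y \<in> degree_zero_center A" "z \<in> degree_zero_center A"
  shows "y \<otimes> z \<in> degree_zero_center A"
proof -
  have "y \<otimes> z \<otimes> x = x \<otimes> (y \<otimes> z)" if x: "x \<in> carrier A" for x
  proof -
    note carr = assms[THEN degree_zero_center_carrier] x
    have "y \<otimes> z \<otimes> x = y \<otimes> (x \<otimes> z)"
      using carr assms by (simp add: m_assoc degree_zero_center_commute[of z x])
    also have "\<dots> = x \<otimes> y \<otimes> z"
      using carr assms by (simp add: m_assoc[symmetric] degree_zero_center_commute[of y x])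
    finally show ?thesis using carr by (simp add: m_assoc)
  qed
  moreover have "y \<otimes> z \<in> homogeneous A 0"
    using assms homogeneous_times by (auto simp: degree_zero_center_def)
  ultimately show ?thesis by (simp add: degree_zero_center_def)
qed

lemma scalar_carrier [simp]: "c \<odot> \<one> \<in> carrier A"
  using degree_zero_center_carrier[OF scalar_central] .

lemma idempotent_carrier: "s \<in> S \<Longrightarrow> e s \<in> carrier A"
  using degree_zero_center_carrier[OF idempotent_central] .

lemma scalar_zero: "0 \<odot> \<one> = \<zero>"
  using scalar_add[of 0 0] by simp

text \<open>
  The scalars form a field, so a nonzero scalar that kills \<open>e s\<close> would make \<open>e s\<close> zero.
\<close>

lemma scalar_idempotent_cancel:
  assumes s: "s \<in> S" and eq: "c \<odot> \<one> \<otimes> e s = d \<odot> \<one> \<otimes> e s"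
  shows "c = d"
proof (rule ccontr)
  assume "c \<noteq> d"
  let ?k = "c - d"
  have c: "c \<odot> \<one> = ?k \<odot> \<one> \<oplus> d \<odot> \<one>"
    using scalar_add[of ?k d] by simp
  have "?k \<odot> \<one> \<otimes> e s \<oplus> d \<odot> \<one> \<otimes> e s = d \<odot> \<one> \<otimes> e s"
    using eq s by (simp add: c l_distr idempotent_carrier)
  then have "?k \<odot> \<one> \<otimes> e s = \<zero>"
    using s by (metis add.r_cancel_one' idempotent_carrier m_closed scalar_carrier)
  then have "(inverse ?k \<odot> \<one>) \<otimes> (?k \<odot> \<one> \<otimes> e s) = \<zero>"
    by simp
  then have "(inverse ?k * ?k) \<odot> \<one> \<otimes> e s = \<zero>"
    using s by (simp add: scalar_mult m_assoc idempotent_carrier)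
  with \<open>c \<noteq> d\<close> have "e s = \<zero>"
    using s by (simp add: scalar_one idempotent_carrier)
  with idempotent_nonzero[OF s] show False by simp
qed

lemma separation_eq:
  assumes "x \<in> carrier A" "y \<in> carrier A" "\<And>s. s \<in> S \<Longrightarrow> e s \<otimes> x = e s \<otimes> y"
  shows "x = y"
proof -
  have "x \<ominus> y = \<zero>"
  proof (rule separation)
  qed (use assms in \<open>simp_all add: idempotent_carrier minus_eq r_distr r_minus r_neg\<close>)
  moreover have "x = (x \<ominus> y) \<oplus> y" using assms by (simp add: minus_eq a_assoc l_neg)
  ultimately show ?thesis using assms by simp
qed

lemma center_scalar:
  assumes "z \<in> degree_zero_center A" "s \<in> S"
  shows "\<exists>k. z \<otimes> e s = k \<odot> \<one> \<otimes> e s"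
  using center_spanned[OF assms] smult_scalar[OF idempotent_carrier[OF assms(2)]] by metis

end

text \<open>
  On the block of \<open>f s\<close> the isomorphism \<open>\<phi>\<close> is semilinear for a field automorphism \<open>\<sigma> s\<close>. The
  twist \<open>T s\<close> of \<open>B\<close> by the inverse of \<open>\<sigma> s\<close> is semilinear the other way round, so
  assembling the maps \<open>T s \<circ> \<phi>\<close> over all blocks gives a linear map \<open>\<psi>\<close>. It is
  multiplicative, bijective and graded because each \<open>T s\<close> is so and fixes \<open>f s\<close>.

  That \<open>\<sigma> s\<close> is onto needs an argument. As \<open>f s \<noteq> 0\<close> and the \<open>e r\<close> separate points,
  some \<open>\<phi> (e r) f s\<close> is nonzero. It is \<open>k f s\<close> with a scalar \<open>k\<close> that is idempotent, hence \<open>1\<close>.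
  Now \<open>a f s\<close> is the image of some \<open>y\<close> in the degree-zero centre of \<open>A\<close>, which acts on the block of
  \<open>e r\<close> by a scalar \<open>b\<close>, and comparing gives \<open>\<sigma> s b = a\<close>.
\<close>

lemma graded_ring_isomorphic_imp_algebra:
  fixes A :: "('k::field, 'a) graded_algebra" and B :: "('k, 'b) graded_algebra"
  assumes "split_graded_algebra A S e p" and "split_graded_algebra B S' f p'"
    and iso: "graded_ring_isomorphic A B"
  shows "graded_algebra_isomorphic A B"
proof -
  interpret A: split_graded_algebra A S e p by fact
  interpret B: split_graded_algebra B S' f p' by fact
  obtain \<phi> where \<phi>: "\<phi> \<in> ring_iso A B" and \<phi>_deg: "\<And>n. \<phi> ` homogeneous A n \<subseteq> homogeneous B n"
    using iso by (auto simp: graded_ring_isomorphic_def graded_ring_iso_def)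
  have hom: "\<phi> \<in> ring_hom A B" and bij: "bij_betw \<phi> (carrier A) (carrier B)"
    using \<phi> by (auto simp: ring_iso_def)
  note closed = ring_hom_closed[OF hom] and mult = ring_hom_mult[OF hom]
    and add = ring_hom_add[OF hom] and one = ring_hom_one[OF hom]
  have inj: "inj_on \<phi> (carrier A)" and surj: "\<phi> ` carrier A = carrier B"
    using bij by (auto simp: bij_betw_def)
  have zero: "\<phi> \<zero>\<^bsub>A\<^esub> = \<zero>\<^bsub>B\<^esub>"
    using hom by (intro ring_hom_zero) (auto intro: A.ring_axioms B.ring_axioms)
  \<comment> \<open>Only \<open>\<phi>\<close> itself is known to be graded. That its inverse respects degree zero follows because \<open>\<phi>\<close>
    commutes with taking the part of degree zero, as one sees on homogeneous elements.\<close>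
  have deg0: "\<phi> (p x) = p' (\<phi> x)" if "x \<in> carrier A" for x
    using that
  proof (rule A.homogeneous_induct)
    fix n x assume x: "x \<in> homogeneous A n"
    then have "\<phi> x \<in> homogeneous B n" using \<phi>_deg by auto
    with x show "\<phi> (p x) = p' (\<phi> x)"
      by (simp add: A.deg0_part_homogeneous B.deg0_part_homogeneous zero)
  next
    fix x y assume xy: "x \<in> carrier A" "y \<in> carrier A" "\<phi> (p x) = p' (\<phi> x)" "\<phi> (p y) = p' (\<phi> y)"
    have "p x \<in> carrier A" "p y \<in> carrier A"
      using xy(1,2) A.deg0_part_closed A.homogeneous_carrier by blast+
    with xy show "\<phi> (p (x \<oplus>\<^bsub>A\<^esub> y)) = p' (\<phi> (x \<oplus>\<^bsub>A\<^esub> y))"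
      by (simp add: A.deg0_part_add B.deg0_part_add add closed)
  qed
  have center: "\<phi> z \<in> degree_zero_center B" if z: "z \<in> degree_zero_center A" for z
  proof -
    have "\<phi> z \<otimes>\<^bsub>B\<^esub> y = y \<otimes>\<^bsub>B\<^esub> \<phi> z" if y: "y \<in> carrier B" for y
    proof -
      obtain x where x: "x \<in> carrier A" "y = \<phi> x" using y surj by auto
      then show ?thesis
        using A.degree_zero_center_commute[OF z x(1)] A.degree_zero_center_carrier[OF z]
        by (metis mult)
    qed
    then show ?thesis using z \<phi>_deg by (auto simp: degree_zero_center_def)
  qed
  have center_surj: "\<exists>y \<in> degree_zero_center A. z = \<phi> y" if z: "z \<in> degree_zero_center B" for z
  proof -
    obtain y where y: "y \<in> carrier A" "z = \<phi> y"
      using B.degree_zero_center_carrier[OF z] surj by auto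
    have "\<phi> (p y) = \<phi> y"
      using deg0[OF y(1)] z y(2) B.deg0_part_homogeneous[of z 0]
      by (auto simp: degree_zero_center_def)
    moreover have "p y \<in> homogeneous A 0" using y A.deg0_part_closed by auto
    ultimately have "y \<in> homogeneous A 0"
      using inj y A.homogeneous_carrier[of 0] by (metis inj_onD subsetD)
    moreover have "y \<otimes>\<^bsub>A\<^esub> x = x \<otimes>\<^bsub>A\<^esub> y" if x: "x \<in> carrier A" for x
    proof (rule inj_onD[OF inj])
      show "\<phi> (y \<otimes>\<^bsub>A\<^esub> x) = \<phi> (x \<otimes>\<^bsub>A\<^esub> y)"
        using B.degree_zero_center_commute[OF z closed[OF x]] x y by (simp add: mult)
    qed (use x y in auto)
    ultimately show ?thesis using y by (auto simp: degree_zero_center_def)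
  qed
  define \<sigma> where "\<sigma> s c = (THE d. \<phi> (c \<odot>\<^bsub>A\<^esub> \<one>\<^bsub>A\<^esub>) \<otimes>\<^bsub>B\<^esub> f s = d \<odot>\<^bsub>B\<^esub> \<one>\<^bsub>B\<^esub> \<otimes>\<^bsub>B\<^esub> f s)" for s c
  have \<sigma>I: "\<sigma> s c = d" if "\<phi> (c \<odot>\<^bsub>A\<^esub> \<one>\<^bsub>A\<^esub>) \<otimes>\<^bsub>B\<^esub> f s = d \<odot>\<^bsub>B\<^esub> \<one>\<^bsub>B\<^esub> \<otimes>\<^bsub>B\<^esub> f s" "s \<in> S'" for s c d
    unfolding \<sigma>_def using that
    by (intro the_equality) (auto intro: B.scalar_idempotent_cancel)
  have \<sigma>: "\<phi> (c \<odot>\<^bsub>A\<^esub> \<one>\<^bsub>A\<^esub>) \<otimes>\<^bsub>B\<^esub> f s = \<sigma> s c \<odot>\<^bsub>B\<^esub> \<one>\<^bsub>B\<^esub> \<otimes>\<^bsub>B\<^esub> f s" if s: "s \<in> S'" for s c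
    using B.center_scalar[OF center[OF A.scalar_central] s] \<sigma>I[OF _ s] by metis
  note fcarr = B.idempotent_carrier
  have \<sigma>_one: "\<sigma> s 1 = 1" if "s \<in> S'" for s
    using that by (intro \<sigma>I) (simp_all add: A.scalar_one B.scalar_one one)
  have \<sigma>_add: "\<sigma> s (c + d) = \<sigma> s c + \<sigma> s d" if s: "s \<in> S'" for s c d
    using s by (intro \<sigma>I)
      (simp_all add: A.scalar_add B.scalar_add add closed B.l_distr fcarr \<sigma>)
  have \<sigma>_mult: "\<sigma> s (c * d) = \<sigma> s c * \<sigma> s d" if s: "s \<in> S'" for s c d
  proof (rule \<sigma>I[OF _ s])
    let ?a = "\<lambda>c. c \<odot>\<^bsub>A\<^esub> \<one>\<^bsub>A\<^esub>" and ?b = "\<lambda>c. c \<odot>\<^bsub>B\<^esub> \<one>\<^bsub>B\<^esub>"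
    have "\<phi> (?a (c * d)) \<otimes>\<^bsub>B\<^esub> f s = \<phi> (?a c) \<otimes>\<^bsub>B\<^esub> (\<phi> (?a d) \<otimes>\<^bsub>B\<^esub> f s)"
      using s by (simp add: A.scalar_mult mult B.m_assoc closed fcarr)
    also have "\<dots> = \<phi> (?a c) \<otimes>\<^bsub>B\<^esub> (f s \<otimes>\<^bsub>B\<^esub> ?b (\<sigma> s d))"
      using s B.degree_zero_center_commute[OF B.scalar_central fcarr] by (simp add: \<sigma>)
    also have "\<dots> = ?b (\<sigma> s c) \<otimes>\<^bsub>B\<^esub> (f s \<otimes>\<^bsub>B\<^esub> ?b (\<sigma> s d))"
      using s \<sigma>[OF s, of c] by (simp add: B.m_assoc[symmetric] closed fcarr)
    also have "\<dots> = ?b (\<sigma> s c * \<sigma> s d) \<otimes>\<^bsub>B\<^esub> f s"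
      using s B.degree_zero_center_commute[OF B.scalar_central fcarr, of s "\<sigma> s d"]
      by (simp add: B.scalar_mult B.m_assoc fcarr)
    finally show "\<phi> (?a (c * d)) \<otimes>\<^bsub>B\<^esub> f s = ?b (\<sigma> s c * \<sigma> s d) \<otimes>\<^bsub>B\<^esub> f s" .
  qed
  have \<sigma>_inj: "inj (\<sigma> s)" if s: "s \<in> S'" for s
  proof (rule injI, rule ccontr)
    fix c d assume eq: "\<sigma> s c = \<sigma> s d" and "c \<noteq> d"
    have "\<sigma> s (c - d) = 0" using \<sigma>_add[OF s, of "c - d" d] eq by simp
    moreover have "\<sigma> s (inverse (c - d) * (c - d)) = 1" using \<open>c \<noteq> d\<close> s by (simp add: \<sigma>_one)
    ultimately show False using s by (simp add: \<sigma>_mult)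
  qed
  have \<sigma>_surj: "surj (\<sigma> s)" if s: "s \<in> S'" for s
    unfolding surj_def
  proof
    fix a
    have "\<exists>r \<in> S. \<phi> (e r) \<otimes>\<^bsub>B\<^esub> f s \<noteq> \<zero>\<^bsub>B\<^esub>"
    proof (rule ccontr)
      assume none: "\<not> ?thesis"
      obtain x where x: "x \<in> carrier A" "f s = \<phi> x" using fcarr[OF s] surj by auto
      have "e r \<otimes>\<^bsub>A\<^esub> x = \<zero>\<^bsub>A\<^esub>" if r: "r \<in> S" for r
      proof (rule inj_onD[OF inj])
        show "\<phi> (e r \<otimes>\<^bsub>A\<^esub> x) = \<phi> \<zero>\<^bsub>A\<^esub>"
          using none r x by (simp add: mult A.idempotent_carrier zero)
      qed (use r x in \<open>auto simp: A.idempotent_carrier\<close>)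
      then have "x = \<zero>\<^bsub>A\<^esub>" using A.separation x(1) by blast
      with x zero B.idempotent_nonzero[OF s] show False by simp
    qed
    then obtain r where r: "r \<in> S" and nz: "\<phi> (e r) \<otimes>\<^bsub>B\<^esub> f s \<noteq> \<zero>\<^bsub>B\<^esub>" by auto
    let ?b = "\<lambda>c. c \<odot>\<^bsub>B\<^esub> \<one>\<^bsub>B\<^esub>"
    note er = A.idempotent_carrier[OF r] and fs = fcarr[OF s]
    obtain k where k: "\<phi> (e r) \<otimes>\<^bsub>B\<^esub> f s = ?b k \<otimes>\<^bsub>B\<^esub> f s"
      using B.center_scalar[OF center[OF A.idempotent_central[OF r]] s] by auto
    have "?b (k * k) \<otimes>\<^bsub>B\<^esub> f s = ?b k \<otimes>\<^bsub>B\<^esub> (\<phi> (e r) \<otimes>\<^bsub>B\<^esub> f s)"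
      by (simp add: B.scalar_mult B.m_assoc fs k)
    also have "\<dots> = \<phi> (e r) \<otimes>\<^bsub>B\<^esub> (?b k \<otimes>\<^bsub>B\<^esub> f s)"
      using er fs B.degree_zero_center_commute[OF B.scalar_central, of "\<phi> (e r)" k]
      by (simp add: B.m_assoc[symmetric] closed)
    also have "\<dots> = \<phi> (e r \<otimes>\<^bsub>A\<^esub> e r) \<otimes>\<^bsub>B\<^esub> f s"
      using er fs by (simp add: k[symmetric] B.m_assoc closed mult)
    finally have "k * k = k"
      using k A.idempotent[OF r] by (intro B.scalar_idempotent_cancel[OF s]) simp
    moreover have "k \<noteq> 0" using nz k fs by (auto simp: B.scalar_zero)
    ultimately have "k = 1" by simp
    with k have one_s: "\<phi> (e r) \<otimes>\<^bsub>B\<^esub> f s = f s" using fs by (simp add: B.scalar_one)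
    obtain y where y: "y \<in> degree_zero_center A" "?b a \<otimes>\<^bsub>B\<^esub> f s = \<phi> y"
      using center_surj[OF B.degree_zero_center_times[OF B.scalar_central B.idempotent_central[OF s]]]
      by metis
    obtain b where b: "y \<otimes>\<^bsub>A\<^esub> e r = b \<odot>\<^bsub>A\<^esub> \<one>\<^bsub>A\<^esub> \<otimes>\<^bsub>A\<^esub> e r"
      using A.center_scalar[OF y(1) r] by auto
    have "?b a \<otimes>\<^bsub>B\<^esub> f s = (?b a \<otimes>\<^bsub>B\<^esub> f s) \<otimes>\<^bsub>B\<^esub> (\<phi> (e r) \<otimes>\<^bsub>B\<^esub> f s)"
      using fs s by (simp add: one_s B.m_assoc B.idempotent)
    also have "\<dots> = \<phi> (y \<otimes>\<^bsub>A\<^esub> e r) \<otimes>\<^bsub>B\<^esub> f s"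
      using er fs A.degree_zero_center_carrier[OF y(1)] by (simp add: y(2) mult closed B.m_assoc)
    also have "\<dots> = \<phi> (b \<odot>\<^bsub>A\<^esub> \<one>\<^bsub>A\<^esub>) \<otimes>\<^bsub>B\<^esub> f s"
      using er fs by (simp add: b mult closed B.m_assoc one_s)
    finally have "\<sigma> s b = a" using s by (intro \<sigma>I) auto
    then show "\<exists>x. a = \<sigma> s x" by auto
  qed
  have \<sigma>_automorphism: "field_automorphism (\<sigma> s)" if "s \<in> S'" for s
    using that by unfold_locales (auto simp: \<sigma>_one \<sigma>_add \<sigma>_mult bij_def \<sigma>_inj \<sigma>_surj)
  have "\<exists>T \<in> graded_ring_iso B B. (\<forall>c. T (c \<odot>\<^bsub>B\<^esub> \<one>\<^bsub>B\<^esub>) = inv_into UNIV (\<sigma> s) c \<odot>\<^bsub>B\<^esub> \<one>\<^bsub>B\<^esub>)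
      \<and> (\<forall>r \<in> S'. T (f r) = f r)" if "s \<in> S'" for s
    using that
    by (intro B.coefficient_twist field_automorphism.inverse_automorphism \<sigma>_automorphism)
  then obtain T where T: "\<And>s. s \<in> S' \<Longrightarrow> T s \<in> graded_ring_iso B B"
      "\<And>s c. s \<in> S' \<Longrightarrow> T s (c \<odot>\<^bsub>B\<^esub> \<one>\<^bsub>B\<^esub>) = inv_into UNIV (\<sigma> s) c \<odot>\<^bsub>B\<^esub> \<one>\<^bsub>B\<^esub>"
      "\<And>s. s \<in> S' \<Longrightarrow> T s (f s) = f s"
    by metis
  have T_hom: "T s \<in> ring_hom B B" and T_bij: "bij_betw (T s) (carrier B) (carrier B)"
    and T_deg: "T s ` homogeneous B n \<subseteq> homogeneous B n" if "s \<in> S'" for s n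
    using T(1)[OF that] by (auto simp: graded_ring_iso_def ring_iso_def)
  note T_closed = ring_hom_closed[OF T_hom] and T_mult = ring_hom_mult[OF T_hom]
    and T_add = ring_hom_add[OF T_hom] and T_one = ring_hom_one[OF T_hom]
  have "\<exists>y \<in> carrier B. (\<forall>s \<in> S'. f s \<otimes>\<^bsub>B\<^esub> y = f s \<otimes>\<^bsub>B\<^esub> T s (\<phi> x)) \<and>
            (\<forall>n. (\<forall>s \<in> S'. T s (\<phi> x) \<in> homogeneous B n) \<longrightarrow> y \<in> homogeneous B n)"
    if "x \<in> carrier A" for x
    using that by (intro B.assembly) (simp add: T_closed closed)
  then obtain \<psi> where \<psi>_closed: "\<And>x. x \<in> carrier A \<Longrightarrow> \<psi> x \<in> carrier B"
    and \<psi>: "\<And>x s. \<lbrakk>x \<in> carrier A; s \<in> S'\<rbrakk> \<Longrightarrow> f s \<otimes>\<^bsub>B\<^esub> \<psi> x = f s \<otimes>\<^bsub>B\<^esub> T s (\<phi> x)"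
    and \<psi>_deg: "\<And>x n. \<lbrakk>x \<in> carrier A; \<forall>s \<in> S'. T s (\<phi> x) \<in> homogeneous B n\<rbrakk> \<Longrightarrow> \<psi> x \<in> homogeneous B n"
    by metis
  have split_mult: "f s \<otimes>\<^bsub>B\<^esub> (x \<otimes>\<^bsub>B\<^esub> y) = (f s \<otimes>\<^bsub>B\<^esub> x) \<otimes>\<^bsub>B\<^esub> (f s \<otimes>\<^bsub>B\<^esub> y)"
    if s: "s \<in> S'" and xy: "x \<in> carrier B" "y \<in> carrier B" for s x y
  proof -
    note fs = fcarr[OF s]
    have "(f s \<otimes>\<^bsub>B\<^esub> x) \<otimes>\<^bsub>B\<^esub> (f s \<otimes>\<^bsub>B\<^esub> y) = f s \<otimes>\<^bsub>B\<^esub> ((x \<otimes>\<^bsub>B\<^esub> f s) \<otimes>\<^bsub>B\<^esub> y)"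
      using xy fs by (simp add: B.m_assoc)
    also have "x \<otimes>\<^bsub>B\<^esub> f s = f s \<otimes>\<^bsub>B\<^esub> x"
      using B.degree_zero_center_commute[OF B.idempotent_central[OF s] xy(1)] by simp
    also have "f s \<otimes>\<^bsub>B\<^esub> ((f s \<otimes>\<^bsub>B\<^esub> x) \<otimes>\<^bsub>B\<^esub> y) = (f s \<otimes>\<^bsub>B\<^esub> f s) \<otimes>\<^bsub>B\<^esub> (x \<otimes>\<^bsub>B\<^esub> y)"
      using xy fs by (simp add: B.m_assoc)
    finally show ?thesis using s by (simp add: B.idempotent)
  qed
  have \<psi>_hom: "\<psi> \<in> ring_hom A B"
  proof (rule ring_hom_memI)
    fix x y assume x: "x \<in> carrier A" and y: "y \<in> carrier A"
    show "\<psi> (x \<otimes>\<^bsub>A\<^esub> y) = \<psi> x \<otimes>\<^bsub>B\<^esub> \<psi> y"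
    proof (rule B.separation_eq)
      fix s assume s: "s \<in> S'"
      note carr = closed[OF x] closed[OF y] T_closed[OF s closed[OF x]] T_closed[OF s closed[OF y]]
      have "f s \<otimes>\<^bsub>B\<^esub> \<psi> (x \<otimes>\<^bsub>A\<^esub> y) = f s \<otimes>\<^bsub>B\<^esub> (T s (\<phi> x) \<otimes>\<^bsub>B\<^esub> T s (\<phi> y))"
        using x y s carr by (simp add: \<psi> mult T_mult)
      also have "\<dots> = (f s \<otimes>\<^bsub>B\<^esub> \<psi> x) \<otimes>\<^bsub>B\<^esub> (f s \<otimes>\<^bsub>B\<^esub> \<psi> y)"
        by (simp only: split_mult[OF s carr(3,4)] \<psi>[OF x s] \<psi>[OF y s])
      also have "\<dots> = f s \<otimes>\<^bsub>B\<^esub> (\<psi> x \<otimes>\<^bsub>B\<^esub> \<psi> y)"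
        by (rule split_mult[OF s \<psi>_closed[OF x] \<psi>_closed[OF y], symmetric])
      finally show "f s \<otimes>\<^bsub>B\<^esub> \<psi> (x \<otimes>\<^bsub>A\<^esub> y) = f s \<otimes>\<^bsub>B\<^esub> (\<psi> x \<otimes>\<^bsub>B\<^esub> \<psi> y)" .
    qed (use x y in \<open>simp_all add: \<psi>_closed\<close>)
    show "\<psi> (x \<oplus>\<^bsub>A\<^esub> y) = \<psi> x \<oplus>\<^bsub>B\<^esub> \<psi> y"
    proof (rule B.separation_eq)
    qed (use x y in \<open>simp_all add: \<psi>_closed \<psi> B.r_distr fcarr add T_add closed T_closed\<close>)
  next
    show "\<psi> \<one>\<^bsub>A\<^esub> = \<one>\<^bsub>B\<^esub>"
      by (rule B.separation_eq) (simp_all add: \<psi>_closed \<psi> one T_one)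
  qed (use \<psi>_closed in auto)
  have T_f: "f s \<otimes>\<^bsub>B\<^esub> T s y = T s (f s \<otimes>\<^bsub>B\<^esub> y)" if "s \<in> S'" "y \<in> carrier B" for s y
    using that by (simp add: T_mult T(3) fcarr)
  have T_inj: "x = y" if "T s x = T s y" "s \<in> S'" "x \<in> carrier B" "y \<in> carrier B" for s x y
    using T_bij[OF that(2)] that by (auto simp: bij_betw_def inj_on_def)
  have \<psi>_bij: "bij_betw \<psi> (carrier A) (carrier B)"
    unfolding bij_betw_def
  proof
    show "inj_on \<psi> (carrier A)"
    proof (rule inj_onI)
      fix x y assume xy: "x \<in> carrier A" "y \<in> carrier A" and eq: "\<psi> x = \<psi> y"
      have "f s \<otimes>\<^bsub>B\<^esub> \<phi> x = f s \<otimes>\<^bsub>B\<^esub> \<phi> y" if s: "s \<in> S'" for s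
      proof (rule T_inj[OF _ s])
        show "T s (f s \<otimes>\<^bsub>B\<^esub> \<phi> x) = T s (f s \<otimes>\<^bsub>B\<^esub> \<phi> y)"
          using \<psi>[OF xy(1) s] \<psi>[OF xy(2) s] xy s by (simp add: eq T_f closed)
      qed (use xy s in \<open>simp_all add: closed fcarr\<close>)
      then have "\<phi> x = \<phi> y"
        by (rule B.separation_eq[OF closed[OF xy(1)] closed[OF xy(2)]])
      then show "x = y" using inj xy by (auto dest: inj_onD)
    qed
    show "\<psi> ` carrier A = carrier B"
    proof (intro equalityI subsetI)
      fix y assume y: "y \<in> carrier B"
      have "\<exists>x \<in> carrier B. T s x = y" if "s \<in> S'" for s
        using T_bij[OF that] y unfolding bij_betw_def by (metis imageE)
      then obtain g where g: "\<And>s. s \<in> S' \<Longrightarrow> g s \<in> carrier B" "\<And>s. s \<in> S' \<Longrightarrow> T s (g s) = y"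
        by metis
      obtain z where z: "z \<in> carrier B" "\<And>s. s \<in> S' \<Longrightarrow> f s \<otimes>\<^bsub>B\<^esub> z = f s \<otimes>\<^bsub>B\<^esub> g s"
        using B.assembly[of g] g(1) by blast
      obtain x where x: "x \<in> carrier A" "z = \<phi> x" using z(1) surj by auto
      have "f s \<otimes>\<^bsub>B\<^esub> \<psi> x = f s \<otimes>\<^bsub>B\<^esub> y" if s: "s \<in> S'" for s
      proof -
        have "f s \<otimes>\<^bsub>B\<^esub> \<psi> x = T s (f s \<otimes>\<^bsub>B\<^esub> g s)"
          using x z s by (simp add: \<psi> T_f)
        also have "\<dots> = f s \<otimes>\<^bsub>B\<^esub> y" using s by (simp add: T_f[symmetric] g)
        finally show ?thesis .
      qed
      then have "\<psi> x = y" by (rule B.separation_eq[OF \<psi>_closed[OF x(1)] y])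
      with x show "y \<in> \<psi> ` carrier A" by auto
    qed (use \<psi>_closed in auto)
  qed
  have \<psi>_homogeneous: "\<psi> ` homogeneous A n \<subseteq> homogeneous B n" for n
  proof
    fix y assume "y \<in> \<psi> ` homogeneous A n"
    then obtain x where x: "x \<in> homogeneous A n" "y = \<psi> x" by auto
    have "T s (\<phi> x) \<in> homogeneous B n" if "s \<in> S'" for s
      using T_deg[OF that] \<phi>_deg x(1) by blast
    then show "y \<in> homogeneous B n" using x A.homogeneous_carrier \<psi>_deg by blast
  qed
  have \<psi>_linear: "\<psi> (c \<odot>\<^bsub>A\<^esub> x) = c \<odot>\<^bsub>B\<^esub> \<psi> x" if x: "x \<in> carrier A" for c x
  proof -
    let ?a = "c \<odot>\<^bsub>A\<^esub> \<one>\<^bsub>A\<^esub>" and ?b = "\<lambda>c. c \<odot>\<^bsub>B\<^esub> \<one>\<^bsub>B\<^esub>"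
    have "\<psi> ?a = ?b c"
    proof (rule B.separation_eq)
      fix s assume s: "s \<in> S'"
      have "f s \<otimes>\<^bsub>B\<^esub> \<psi> ?a = T s (f s \<otimes>\<^bsub>B\<^esub> \<phi> ?a)"
        using s by (simp add: \<psi> T_f closed)
      also have "f s \<otimes>\<^bsub>B\<^esub> \<phi> ?a = \<phi> ?a \<otimes>\<^bsub>B\<^esub> f s"
        using s by (intro B.degree_zero_center_commute B.idempotent_central) (simp_all add: closed)
      also have "\<dots> = f s \<otimes>\<^bsub>B\<^esub> ?b (\<sigma> s c)"
        using s B.degree_zero_center_commute[OF B.scalar_central fcarr] by (simp add: \<sigma>)
      also have "T s (f s \<otimes>\<^bsub>B\<^esub> ?b (\<sigma> s c)) = f s \<otimes>\<^bsub>B\<^esub> ?b c"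
        using s by (simp add: T_f[symmetric] T(2) inv_f_f[OF \<sigma>_inj])
      finally show "f s \<otimes>\<^bsub>B\<^esub> \<psi> ?a = f s \<otimes>\<^bsub>B\<^esub> ?b c" .
    qed (simp_all add: \<psi>_closed)
    then show ?thesis
      using x ring_hom_mult[OF \<psi>_hom A.scalar_carrier x]
      by (simp add: A.smult_scalar[OF x] B.smult_scalar[OF \<psi>_closed[OF x]])
  qed
  have "\<psi> \<in> graded_algebra_iso A B"
    using \<psi>_hom \<psi>_bij \<psi>_homogeneous \<psi>_linear
    by (simp add: graded_algebra_iso_def graded_ring_iso_def ring_iso_def)
  then show ?thesis by (auto simp: graded_algebra_isomorphic_def)
qed

section \<open>Coefficient twists and degrees in the free algebra\<close>

lemma poly_mapping_monomial_induct [consumes 1, case_names zero monomial add]: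
  assumes "Poly_Mapping.keys f \<subseteq> W"
    and "Q 0"
    and "\<And>w a. w \<in> W \<Longrightarrow> Q (Poly_Mapping.single w a)"
    and "\<And>g h. \<lbrakk>Poly_Mapping.keys g \<subseteq> W; Poly_Mapping.keys h \<subseteq> W; Q g; Q h\<rbrakk> \<Longrightarrow> Q (g + h)"
  shows "Q f"
  using assms(1)
proof (induction f rule: update_induct)
  case const
  then show ?case by (simp add: assms(2))
next
  case (update f w a)
  have eq: "Poly_Mapping.update w a f = Poly_Mapping.single w a + f"
    using update(1) by (intro poly_mapping_eqI)
      (auto simp: lookup_update lookup_add lookup_single not_in_keys_iff_lookup_eq_zero)
  have "w \<in> W" "Poly_Mapping.keys f \<subseteq> W" using update by (auto simp: keys_update)
  then show ?case using update(3) assms(3,4) by (simp add: eq)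
qed

lemma poly_mapping_induct [case_names zero monomial add]:
  assumes "Q 0" and "\<And>w a. Q (Poly_Mapping.single w a)" and "\<And>g h. \<lbrakk>Q g; Q h\<rbrakk> \<Longrightarrow> Q (g + h)"
  shows "Q f"
  using subset_UNIV by (rule poly_mapping_monomial_induct) (use assms in auto)

lemma single_mult_single:
  "Poly_Mapping.single v a * Poly_Mapping.single w b = Poly_Mapping.single (v @ w) (a * b)"
  by (simp add: mult_single plus_list_def)

lemma single_Nil_1 [simp]: "Poly_Mapping.single [] 1 = 1"
  by (subst zero_list_def[symmetric]) (rule single_one)

lemma single_Nil_commute:
  fixes f :: "'x list \<Rightarrow>\<^sub>0 'k::field"
  shows "f * Poly_Mapping.single [] a = Poly_Mapping.single [] a * f"
proof (induction f rule: poly_mapping_induct)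
  case (monomial w b)
  show ?case by (simp add: single_mult_single mult.commute)
qed (simp_all add: algebra_simps)

lemma keys_mult_append:
  assumes "w \<in> Poly_Mapping.keys (f * g)"
  obtains u v where "w = u @ v" "u \<in> Poly_Mapping.keys f" "v \<in> Poly_Mapping.keys g"
  using keys_mult[of f g] assms by (auto simp: plus_list_def)

context field_automorphism
begin

lemma lookup_map: "Poly_Mapping.lookup (Poly_Mapping.map \<sigma> f) w = \<sigma> (Poly_Mapping.lookup f w)"
  by (auto simp: map.rep_eq zero when_def)

lemma map_add: "Poly_Mapping.map \<sigma> (f + g) = Poly_Mapping.map \<sigma> f + Poly_Mapping.map \<sigma> g"
  by (intro poly_mapping_eqI) (simp add: lookup_map lookup_add add)

lemma map_zero [simp]: "Poly_Mapping.map \<sigma> 0 = 0"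
  by (intro poly_mapping_eqI) (simp add: lookup_map zero)

lemma map_single_coeff: "Poly_Mapping.map \<sigma> (Poly_Mapping.single w a) = Poly_Mapping.single w (\<sigma> a)"
  by (intro poly_mapping_eqI) (simp add: lookup_map lookup_single when_def zero)

lemma map_mult:
  fixes f g :: "'x list \<Rightarrow>\<^sub>0 'k"
  shows "Poly_Mapping.map \<sigma> (f * g) = Poly_Mapping.map \<sigma> f * Poly_Mapping.map \<sigma> g"
proof (induction f rule: poly_mapping_induct)
  case (monomial w a)
  show ?case
  proof (induction g rule: poly_mapping_induct)
    case (monomial v b)
    show ?case by (simp only: single_mult_single map_single_coeff mult)
  qed (simp_all add: algebra_simps map_add del: map_single)
qed (simp_all add: algebra_simps map_add)

lemma map_diff: "Poly_Mapping.map \<sigma> (f - g) = Poly_Mapping.map \<sigma> f - Poly_Mapping.map \<sigma> g"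
  using map_add[of "f - g" g] by (simp add: eq_diff_eq)

lemma map_sum: "Poly_Mapping.map \<sigma> (\<Sum>i\<in>A. f i) = (\<Sum>i\<in>A. Poly_Mapping.map \<sigma> (f i))"
  by (induction A rule: infinite_finite_induct) (simp_all add: map_add)

lemma map_var: "Poly_Mapping.map \<sigma> (var x) = var x"
  by (simp only: map_single_coeff one)

lemma keys_map: "Poly_Mapping.keys (Poly_Mapping.map \<sigma> f) = Poly_Mapping.keys f"
proof -
  have eq0: "\<sigma> c = 0 \<longleftrightarrow> c = 0" for c
    using inj_eq[OF bij_is_inj[OF bij], of c 0] by (simp add: zero)
  show ?thesis by (auto simp: in_keys_iff lookup_map eq0)
qed

end

lemma map_inverse_automorphism:
  assumes "field_automorphism \<sigma>"
  shows "Poly_Mapping.map \<sigma> (Poly_Mapping.map (inv_into UNIV \<sigma>) f) = f"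
    and "Poly_Mapping.map (inv_into UNIV \<sigma>) (Poly_Mapping.map \<sigma> f) = f"
proof -
  interpret a: field_automorphism \<sigma> by fact
  interpret b: field_automorphism "inv_into UNIV \<sigma>" by (rule a.inverse_automorphism)
  show "Poly_Mapping.map \<sigma> (Poly_Mapping.map (inv_into UNIV \<sigma>) f) = f"
    using a.bij by (intro poly_mapping_eqI) (simp add: a.lookup_map b.lookup_map bij_is_surj surj_f_inv_f)
  show "Poly_Mapping.map (inv_into UNIV \<sigma>) (Poly_Mapping.map \<sigma> f) = f"
    using a.bij by (intro poly_mapping_eqI) (simp add: a.lookup_map b.lookup_map bij_is_inj)
qed

definition degree_part :: "int \<Rightarrow> (('v, 'e) generator list \<Rightarrow>\<^sub>0 'k::zero) \<Rightarrow> _ \<Rightarrow>\<^sub>0 'k" where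
  "degree_part n f = Poly_Mapping.mapp (\<lambda>w a. a when word_degree w = n) f"

definition of_degree :: "int \<Rightarrow> (('v, 'e) generator list \<Rightarrow>\<^sub>0 'k::zero) \<Rightarrow> bool" where
  "of_degree n f \<longleftrightarrow> (\<forall>w \<in> Poly_Mapping.keys f. word_degree w = n)"

lemma word_degree_append [simp]: "word_degree (v @ w) = word_degree v + word_degree w"
  by (simp add: word_degree_def)

lemma word_degree_Nil [simp]: "word_degree [] = 0"
  and word_degree_Cons [simp]: "word_degree (x # w) = generator_degree x + word_degree w"
  by (simp_all add: word_degree_def)

lemma lookup_degree_part:
  "Poly_Mapping.lookup (degree_part n f) w = (Poly_Mapping.lookup f w when word_degree w = n)"
  by (auto simp: degree_part_def lookup_mapp when_def in_keys_iff)

lemma degree_part_add: "degree_part n (f + g) = degree_part n f + degree_part n g"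
  for f g :: "_ \<Rightarrow>\<^sub>0 'k::comm_monoid_add"
  by (intro poly_mapping_eqI) (simp add: lookup_degree_part lookup_add when_def)

lemma degree_part_diff: "degree_part n (f - g) = degree_part n f - degree_part n g"
  for f g :: "_ \<Rightarrow>\<^sub>0 'k::ab_group_add"
  by (intro poly_mapping_eqI) (simp add: lookup_degree_part lookup_minus when_def)

lemma degree_part_of_degree: "of_degree m f \<Longrightarrow> degree_part n f = (if n = m then f else 0)"
  by (intro poly_mapping_eqI)
    (auto simp: lookup_degree_part of_degree_def when_def in_keys_iff)

lemma of_degree_part: "of_degree n (degree_part n f)"
  by (auto simp: of_degree_def in_keys_iff lookup_degree_part)

lemma keys_degree_part: "Poly_Mapping.keys (degree_part n f) \<subseteq> Poly_Mapping.keys f"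
  by (auto simp: in_keys_iff lookup_degree_part)

lemma of_degree_zero [simp]: "of_degree n 0"
  by (simp add: of_degree_def)

lemma degree_part_zero [simp]: "degree_part n 0 = 0"
  by (intro poly_mapping_eqI) (simp add: lookup_degree_part)

lemma of_degree_single: "word_degree w = n \<Longrightarrow> of_degree n (Poly_Mapping.single w a)"
  by (simp add: of_degree_def)

lemma of_degree_add: "\<lbrakk>of_degree n f; of_degree n g\<rbrakk> \<Longrightarrow> of_degree n (f + g)"
  using keys_add[of f g] by (auto simp: of_degree_def)

lemma of_degree_diff: "\<lbrakk>of_degree n f; of_degree n g\<rbrakk> \<Longrightarrow> of_degree n (f - g)"
  for f g :: "_ \<Rightarrow>\<^sub>0 'k::ab_group_add"
  by (auto simp: of_degree_def in_keys_iff lookup_minus)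

lemma of_degree_sum: "(\<And>i. i \<in> A \<Longrightarrow> of_degree n (f i)) \<Longrightarrow> of_degree n (\<Sum>i\<in>A. f i)"
  by (induction A rule: infinite_finite_induct) (auto intro: of_degree_add)

lemma of_degree_mult: "\<lbrakk>of_degree m f; of_degree n g\<rbrakk> \<Longrightarrow> of_degree (m + n) (f * g)"
  unfolding of_degree_def by (force elim!: keys_mult_append)

lemma degree_part_single_mult:
  fixes f :: "('v, 'e) generator list \<Rightarrow>\<^sub>0 'k::field"
  shows "degree_part n (Poly_Mapping.single w a * f) = Poly_Mapping.single w a * degree_part (n - word_degree w) f"
    and "degree_part n (f * Poly_Mapping.single w a) = degree_part (n - word_degree w) f * Poly_Mapping.single w a"
proof -
  have single: "degree_part n (Poly_Mapping.single w a) = (if word_degree w = n then Poly_Mapping.single w a else 0)"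
    for n w and a :: 'k
    by (simp add: degree_part_of_degree[OF of_degree_single[OF refl]])
  show "degree_part n (Poly_Mapping.single w a * f) = Poly_Mapping.single w a * degree_part (n - word_degree w) f"
  proof (induction f rule: poly_mapping_induct)
    case zero
    show ?case by simp
  qed (auto simp: single_mult_single single distrib_left degree_part_add)
  show "degree_part n (f * Poly_Mapping.single w a) = degree_part (n - word_degree w) f * Poly_Mapping.single w a"
  proof (induction f rule: poly_mapping_induct)
    case zero
    show ?case by simp
  qed (auto simp: single_mult_single single distrib_right degree_part_add)
qed

lemma keys_mult_lists:
  assumes "Poly_Mapping.keys f \<subseteq> lists X" "Poly_Mapping.keys g \<subseteq> lists X"
  shows "Poly_Mapping.keys (f * g) \<subseteq> lists X"
proof
  fix w assume "w \<in> Poly_Mapping.keys (f * g)"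
  then obtain u v where "w = u @ v" "u \<in> Poly_Mapping.keys f" "v \<in> Poly_Mapping.keys g"
    by (rule keys_mult_append)
  then show "w \<in> lists X" using assms by auto
qed

lemma free_algebra_simps [simp]:
  "carrier (free_algebra X) = {f. Poly_Mapping.keys f \<subseteq> lists X}"
  "mult (free_algebra X) = (*)" "one (free_algebra X) = 1"
  "zero (free_algebra X) = 0" "add (free_algebra X) = (+)"
  by (simp_all add: free_algebra_def)

lemma ring_free_algebra: "ring (free_algebra X :: ('x list \<Rightarrow>\<^sub>0 'k::field) ring)"
proof (rule ringI)
  show "abelian_group (free_algebra X :: ('x list \<Rightarrow>\<^sub>0 'k) ring)"
  proof (rule abelian_groupI)
    fix f :: "'x list \<Rightarrow>\<^sub>0 'k"
    assume "f \<in> carrier (free_algebra X)"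
    then show "\<exists>g\<in>carrier (free_algebra X). g \<oplus>\<^bsub>free_algebra X\<^esub> f = \<zero>\<^bsub>free_algebra X\<^esub>"
      by (intro bexI[of _ "- f"]) auto
  qed (use keys_add in \<open>fastforce simp: algebra_simps\<close>)+
  show "monoid (free_algebra X :: ('x list \<Rightarrow>\<^sub>0 'k) ring)"
    by (rule monoidI) (simp_all add: mult.assoc zero_list_def keys_mult_lists)
qed (simp_all add: algebra_simps)

section \<open>Calculating modulo the Leavitt relations\<close>

text \<open>
  All calculations take place in the type of noncommutative polynomials, where ring arithmetic is
  available, with a congruence in place of equality in the quotient. The price is that the factors
  of a product must be known to be polynomials in the generators of the graph.
\<close>

definition leavitt_polys :: "('v, 'e) pre_digraph \<Rightarrow> (('v, 'e) generator list \<Rightarrow>\<^sub>0 'k::field) set" where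
  "leavitt_polys E = carrier (free_algebra (generators E))"

definition leavitt_ideal :: "('v, 'e) pre_digraph \<Rightarrow> (('v, 'e) generator list \<Rightarrow>\<^sub>0 'k::field) set" where
  "leavitt_ideal E = Idl\<^bsub>free_algebra (generators E)\<^esub> (leavitt_relators E)"

abbreviation vx :: "'v \<Rightarrow> ('v, 'e) generator list \<Rightarrow>\<^sub>0 'k::field" where "vx v \<equiv> var (Vertex v)"
abbreviation ed :: "'e \<Rightarrow> ('v, 'e) generator list \<Rightarrow>\<^sub>0 'k::field" where "ed e \<equiv> var (Edge e)"
abbreviation gh :: "'e \<Rightarrow> ('v, 'e) generator list \<Rightarrow>\<^sub>0 'k::field" where "gh e \<equiv> var (Ghost e)"

context fin_digraph
begin

abbreviation polys where "polys \<equiv> leavitt_polys G"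

definition leavitt_cong ::
  "(('a, 'b) generator list \<Rightarrow>\<^sub>0 'k::field) \<Rightarrow> (('a, 'b) generator list \<Rightarrow>\<^sub>0 'k) \<Rightarrow> bool" (infix \<open>\<approx>\<close> 50)
  where "f \<approx> g \<longleftrightarrow> f - g \<in> leavitt_ideal G"

lemma polys_iff: "f \<in> polys \<longleftrightarrow> Poly_Mapping.keys f \<subseteq> lists (generators G)"
  by (simp add: leavitt_polys_def)

lemma polys_zero [simp]: "0 \<in> polys" and polys_one [simp]: "1 \<in> polys"
  by (simp_all add: polys_iff zero_list_def)

lemma polys_add [simp]: "\<lbrakk>f \<in> polys; g \<in> polys\<rbrakk> \<Longrightarrow> f + g \<in> polys"
  using keys_add[of f g] by (auto simp: polys_iff)

lemma polys_uminus [simp]: "f \<in> polys \<Longrightarrow> - f \<in> polys"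
  by (auto simp: polys_iff in_keys_iff)

lemma polys_diff [simp]: "\<lbrakk>f \<in> polys; g \<in> polys\<rbrakk> \<Longrightarrow> f - g \<in> polys"
  using polys_add[of f "- g"] by simp

lemma polys_mult [simp]: "\<lbrakk>f \<in> polys; g \<in> polys\<rbrakk> \<Longrightarrow> f * g \<in> polys"
  by (simp add: polys_iff keys_mult_lists)

lemma polys_sum [simp]: "(\<And>i. i \<in> A \<Longrightarrow> f i \<in> polys) \<Longrightarrow> (\<Sum>i\<in>A. f i) \<in> polys"
  by (induction A rule: infinite_finite_induct) auto

lemma polys_single [simp]: "w \<in> lists (generators G) \<Longrightarrow> Poly_Mapping.single w a \<in> polys"
  by (auto simp: polys_iff)

lemma Vertex_generators [simp]: "Vertex v \<in> generators G \<longleftrightarrow> v \<in> verts G"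
  and Edge_generators [simp]: "Edge e \<in> generators G \<longleftrightarrow> e \<in> arcs G"
  and Ghost_generators [simp]: "Ghost e \<in> generators G \<longleftrightarrow> e \<in> arcs G"
  by (auto simp: generators_def)

lemma leavitt_relators_polys: "leavitt_relators G \<subseteq> polys"
  by (auto simp: leavitt_relators_def intro!: polys_diff polys_sum polys_mult)

lemma ideal_leavitt_ideal:
  "ideal (leavitt_ideal G :: (_ \<Rightarrow>\<^sub>0 'k::field) set) (free_algebra (generators G))"
  unfolding leavitt_ideal_def
  by (rule ring.genideal_ideal[OF ring_free_algebra])
     (use leavitt_relators_polys in \<open>simp add: leavitt_polys_def\<close>)

lemma leavitt_relators_ideal: "leavitt_relators G \<subseteq> leavitt_ideal G"
  unfolding leavitt_ideal_def
  by (rule ring.genideal_self[OF ring_free_algebra])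
     (use leavitt_relators_polys in \<open>simp add: leavitt_polys_def\<close>)

lemma ideal_polys: "f \<in> leavitt_ideal G \<Longrightarrow> f \<in> polys"
  using ideal.Icarr[OF ideal_leavitt_ideal] by (simp add: leavitt_polys_def)

lemma ideal_zero [simp]: "0 \<in> leavitt_ideal G"
  using additive_subgroup.zero_closed[OF ideal.axioms(1)[OF ideal_leavitt_ideal]] by simp

lemma ideal_add: "\<lbrakk>f \<in> leavitt_ideal G; g \<in> leavitt_ideal G\<rbrakk> \<Longrightarrow> f + g \<in> leavitt_ideal G"
  using additive_subgroup.a_closed[OF ideal.axioms(1)[OF ideal_leavitt_ideal]] by simp

lemma ideal_mult_left: "\<lbrakk>f \<in> leavitt_ideal G; g \<in> polys\<rbrakk> \<Longrightarrow> g * f \<in> leavitt_ideal G"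
  and ideal_mult_right: "\<lbrakk>f \<in> leavitt_ideal G; g \<in> polys\<rbrakk> \<Longrightarrow> f * g \<in> leavitt_ideal G"
  using ideal.I_l_closed[OF ideal_leavitt_ideal] ideal.I_r_closed[OF ideal_leavitt_ideal]
  by (simp_all add: leavitt_polys_def)

lemma ideal_uminus: "f \<in> leavitt_ideal G \<Longrightarrow> - f \<in> leavitt_ideal G"
  using ideal_mult_left[of f "- 1"] by simp

text \<open>
  Closure under multiplication by monomials already gives an ideal. This is what makes
  the ideal accessible to maps that are only understood on monomials, such as coefficient twists and
  projections onto a degree.
\<close>

lemma leavitt_ideal_induct [consumes 1, case_names relator zero add left right]:
  fixes f :: "_ \<Rightarrow>\<^sub>0 'k::field"
  assumes f: "f \<in> leavitt_ideal G"
    and relator: "\<And>r. r \<in> leavitt_relators G \<Longrightarrow> Q r"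
    and zero: "Q 0"
    and add: "\<And>f g. \<lbrakk>Q f; Q g\<rbrakk> \<Longrightarrow> Q (f + g)"
    and left: "\<And>f w a. \<lbrakk>Q f; w \<in> lists (generators G)\<rbrakk> \<Longrightarrow> Q (Poly_Mapping.single w a * f)"
    and right: "\<And>f w a. \<lbrakk>Q f; w \<in> lists (generators G)\<rbrakk> \<Longrightarrow> Q (f * Poly_Mapping.single w a)"
  shows "Q f"
proof -
  let ?F = "free_algebra (generators G) :: (('a, 'b) generator list \<Rightarrow>\<^sub>0 'k) ring"
  let ?J = "{f \<in> polys. Q f}"
  have left': "Q (g * f)" if "Q f" "g \<in> polys" for f g
    using that(2)[unfolded polys_iff]
  proof (induction g rule: poly_mapping_monomial_induct)
    case zero
    show ?case by (simp add: assms(3))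
  next
    case (add g h)
    then show ?case by (simp add: distrib_right assms(4))
  qed (use that(1) in \<open>simp add: left\<close>)
  have right': "Q (f * g)" if "Q f" "g \<in> polys" for f g
    using that(2)[unfolded polys_iff]
  proof (induction g rule: poly_mapping_monomial_induct)
    case zero
    show ?case by (simp add: assms(3))
  next
    case (add g h)
    then show ?case by (simp add: distrib_left assms(4))
  qed (use that(1) in \<open>simp add: right\<close>)
  have "ideal ?J ?F"
  proof (rule idealI)
    show "ring ?F" by (rule ring_free_algebra)
    interpret F: ring ?F by (rule ring_free_algebra)
    show "subgroup ?J (add_monoid ?F)"
    proof (rule F.add.subgroupI)
      fix f assume f: "f \<in> ?J"
      have "\<ominus>\<^bsub>?F\<^esub> f = - 1 * f"
        by (rule F.minus_equality) (use f in \<open>auto simp: polys_iff\<close>)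
      then show "\<ominus>\<^bsub>?F\<^esub> f \<in> ?J" using f left'[of f "- 1"] by simp
    next
      show "?J \<noteq> {}" using zero polys_zero by blast
    qed (use add in \<open>auto simp: polys_iff[symmetric]\<close>)
  qed (use left' right' in \<open>auto simp: polys_iff[symmetric]\<close>)
  moreover have "leavitt_relators G \<subseteq> ?J" using relator leavitt_relators_polys by auto
  ultimately have "leavitt_ideal G \<subseteq> ?J"
    unfolding leavitt_ideal_def by (rule ring.genideal_minimal[OF ring_free_algebra])
  then show ?thesis using f by auto
qed

lemma cong_refl [simp]: "f \<approx> f"
  by (simp add: leavitt_cong_def)

lemma cong_sym: "f \<approx> g \<Longrightarrow> g \<approx> f"
  using ideal_uminus[of "f - g"] by (simp add: leavitt_cong_def)

lemma cong_trans [trans]: "\<lbrakk>f \<approx> g; g \<approx> h\<rbrakk> \<Longrightarrow> f \<approx> h"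
  using ideal_add[of "f - g" "g - h"] by (simp add: leavitt_cong_def)

lemma cong_add: "\<lbrakk>f \<approx> f'; g \<approx> g'\<rbrakk> \<Longrightarrow> f + g \<approx> f' + g'"
  using ideal_add[of "f - f'" "g - g'"] by (simp add: leavitt_cong_def algebra_simps)

lemma cong_uminus: "f \<approx> f' \<Longrightarrow> - f \<approx> - f'"
  using ideal_uminus[of "f - f'"] by (simp add: leavitt_cong_def algebra_simps)

lemma cong_diff: "\<lbrakk>f \<approx> f'; g \<approx> g'\<rbrakk> \<Longrightarrow> f - g \<approx> f' - g'"
  using cong_add[OF _ cong_uminus] by fastforce

lemma cong_left: "\<lbrakk>f \<approx> f'; g \<in> polys\<rbrakk> \<Longrightarrow> g * f \<approx> g * f'"
  using ideal_mult_left[of "f - f'" g] by (simp add: leavitt_cong_def right_diff_distrib)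

lemma cong_right: "\<lbrakk>f \<approx> f'; g \<in> polys\<rbrakk> \<Longrightarrow> f * g \<approx> f' * g"
  using ideal_mult_right[of "f - f'" g] by (simp add: leavitt_cong_def left_diff_distrib)

lemma cong_sum: "(\<And>i. i \<in> A \<Longrightarrow> f i \<approx> g i) \<Longrightarrow> (\<Sum>i\<in>A. f i) \<approx> (\<Sum>i\<in>A. g i)"
  by (induction A rule: infinite_finite_induct) (auto intro: cong_add)

lemma cong_zero_left: "\<lbrakk>f \<approx> 0; g \<in> polys\<rbrakk> \<Longrightarrow> g * f \<approx> 0"
  using cong_left[of f 0 g] by simp

lemma cong_zero_right: "\<lbrakk>f \<approx> 0; g \<in> polys\<rbrakk> \<Longrightarrow> f * g \<approx> 0"
  using cong_right[of f 0 g] by simp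

lemma cong_diff_iff: "f - g \<approx> 0 \<longleftrightarrow> f \<approx> g"
  by (simp add: leavitt_cong_def)

lemma relator_cong: "f - g \<in> leavitt_relators G \<Longrightarrow> f \<approx> g"
  using leavitt_relators_ideal by (auto simp: leavitt_cong_def)

lemma vertex_vertex:
  "\<lbrakk>u \<in> verts G; v \<in> verts G\<rbrakk> \<Longrightarrow> vx u * vx v \<approx> (if u = v then vx u else 0)"
  by (rule relator_cong) (auto simp only: leavitt_relators_def Un_iff mem_Collect_eq)

lemma tail_edge: "e \<in> arcs G \<Longrightarrow> vx (tail G e) * ed e \<approx> ed e"
  by (rule relator_cong) (auto simp only: leavitt_relators_def Un_iff mem_Collect_eq)

lemma edge_head: "e \<in> arcs G \<Longrightarrow> ed e * vx (head G e) \<approx> ed e"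
  by (rule relator_cong) (auto simp only: leavitt_relators_def Un_iff mem_Collect_eq)

lemma head_ghost: "e \<in> arcs G \<Longrightarrow> vx (head G e) * gh e \<approx> gh e"
  by (rule relator_cong) (auto simp only: leavitt_relators_def Un_iff mem_Collect_eq)

lemma ghost_tail: "e \<in> arcs G \<Longrightarrow> gh e * vx (tail G e) \<approx> gh e"
  by (rule relator_cong) (auto simp only: leavitt_relators_def Un_iff mem_Collect_eq)

lemma ghost_edge:
  "\<lbrakk>e \<in> arcs G; f \<in> arcs G\<rbrakk> \<Longrightarrow> gh e * ed f \<approx> (if e = f then vx (head G e) else 0)"
  by (rule relator_cong) (auto simp only: leavitt_relators_def Un_iff mem_Collect_eq)

lemma sum_edge_ghost:
  "\<lbrakk>v \<in> verts G; out_arcs G v \<noteq> {}\<rbrakk> \<Longrightarrow> (\<Sum>e\<in>out_arcs G v. ed e * gh e) \<approx> vx v"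
  by (rule relator_cong) (auto simp only: leavitt_relators_def Un_iff mem_Collect_eq finite_out_arcs)

text \<open>
  The relations only mention products with the matching end of an edge. Inserting that end
  and using orthogonality of the vertices shows that all other products vanish.
\<close>

lemma vertex_edge:
  assumes "v \<in> verts G" "e \<in> arcs G"
  shows "vx v * ed e \<approx> (if v = tail G e then ed e else 0)"
proof (cases "v = tail G e")
  case False
  have "vx v * ed e \<approx> vx v * (vx (tail G e) * ed e)"
    using assms by (intro cong_left cong_sym[OF tail_edge]) auto
  also have "\<dots> = (vx v * vx (tail G e)) * ed e" by (simp add: mult.assoc)
  also have "\<dots> \<approx> 0"
    using assms False vertex_vertex[of v "tail G e"] by - (rule cong_zero_right, auto)
  finally show ?thesis using False by simp
qed (use assms tail_edge in auto)

lemma edge_vertex: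
  assumes "v \<in> verts G" "e \<in> arcs G"
  shows "ed e * vx v \<approx> (if v = head G e then ed e else 0)"
proof (cases "v = head G e")
  case False
  have "ed e * vx v \<approx> (ed e * vx (head G e)) * vx v"
    using assms by (intro cong_right cong_sym[OF edge_head]) auto
  also have "\<dots> = ed e * (vx (head G e) * vx v)" by (simp add: mult.assoc)
  also have "\<dots> \<approx> 0"
    using assms False vertex_vertex[of "head G e" v] by - (rule cong_zero_left, auto)
  finally show ?thesis using False by simp
qed (use assms edge_head in auto)

lemma vertex_ghost:
  assumes "v \<in> verts G" "e \<in> arcs G"
  shows "vx v * gh e \<approx> (if v = head G e then gh e else 0)"
proof (cases "v = head G e")
  case False
  have "vx v * gh e \<approx> vx v * (vx (head G e) * gh e)"
    using assms by (intro cong_left cong_sym[OF head_ghost]) auto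
  also have "\<dots> = (vx v * vx (head G e)) * gh e" by (simp add: mult.assoc)
  also have "\<dots> \<approx> 0"
    using assms False vertex_vertex[of v "head G e"] by - (rule cong_zero_right, auto)
  finally show ?thesis using False by simp
qed (use assms head_ghost in auto)

lemma ghost_vertex:
  assumes "v \<in> verts G" "e \<in> arcs G"
  shows "gh e * vx v \<approx> (if v = tail G e then gh e else 0)"
proof (cases "v = tail G e")
  case False
  have "gh e * vx v \<approx> (gh e * vx (tail G e)) * vx v"
    using assms by (intro cong_right cong_sym[OF ghost_tail]) auto
  also have "\<dots> = gh e * (vx (tail G e) * vx v)" by (simp add: mult.assoc)
  also have "\<dots> \<approx> 0"
    using assms False vertex_vertex[of "tail G e" v] by - (rule cong_zero_left, auto)
  finally show ?thesis using False by simp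
qed (use assms ghost_tail in auto)

definition unit_poly :: "('a, 'b) generator list \<Rightarrow>\<^sub>0 'k::field" where
  "unit_poly = (\<Sum>v\<in>verts G. vx v)"

lemma unit_poly_polys [simp]: "unit_poly \<in> polys"
  by (simp add: unit_poly_def)

lemma sum_single_vertex:
  assumes "u \<in> verts G"
  shows "(\<Sum>v\<in>verts G. if v = u then f else 0) = (f :: _ \<Rightarrow>\<^sub>0 'k::field)"
  using assms by (simp add: sum.delta)

primrec generator_source :: "('a, 'b) generator \<Rightarrow> 'a" where
  "generator_source (Vertex v) = v"
| "generator_source (Edge e) = tail G e"
| "generator_source (Ghost e) = head G e"

primrec generator_range :: "('a, 'b) generator \<Rightarrow> 'a" where
  "generator_range (Vertex v) = v"
| "generator_range (Edge e) = head G e"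
| "generator_range (Ghost e) = tail G e"

lemma generator_ends_verts:
  "x \<in> generators G \<Longrightarrow> generator_source x \<in> verts G"
  "x \<in> generators G \<Longrightarrow> generator_range x \<in> verts G"
  by (cases x; simp)+

lemma vertex_generator:
  assumes "v \<in> verts G" "x \<in> generators G"
  shows "(vx v :: _ \<Rightarrow>\<^sub>0 'k::field) * var x \<approx> (if v = generator_source x then var x else 0)"
proof (cases x)
  case (Vertex u)
  have "(vx v :: _ \<Rightarrow>\<^sub>0 'k) * vx u \<approx> (if v = u then vx v else 0)"
    using assms Vertex by (intro vertex_vertex) auto
  then show ?thesis using Vertex by (auto split: if_splits)
next
  case (Edge e)
  show ?thesis
    unfolding Edge generator_source.simps using assms Edge by (intro vertex_edge) auto
next
  case (Ghost e)
  show ?thesis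
    unfolding Ghost generator_source.simps using assms Ghost by (intro vertex_ghost) auto
qed

lemma generator_vertex:
  assumes "v \<in> verts G" "x \<in> generators G"
  shows "(var x :: _ \<Rightarrow>\<^sub>0 'k::field) * vx v \<approx> (if v = generator_range x then var x else 0)"
proof (cases x)
  case (Vertex u)
  have "(vx u :: _ \<Rightarrow>\<^sub>0 'k) * vx v \<approx> (if u = v then vx u else 0)"
    using assms Vertex by (intro vertex_vertex) auto
  then show ?thesis using Vertex by (auto split: if_splits)
next
  case (Edge e)
  show ?thesis
    unfolding Edge generator_range.simps using assms Edge by (intro edge_vertex) auto
next
  case (Ghost e)
  show ?thesis
    unfolding Ghost generator_range.simps using assms Ghost by (intro ghost_vertex) auto
qed

lemma unit_generator:
  assumes x: "x \<in> generators G"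
  shows "unit_poly * var x \<approx> var x" and "var x * unit_poly \<approx> var x"
proof -
  have "unit_poly * var x \<approx> (\<Sum>v\<in>verts G. if v = generator_source x then var x else 0)"
    unfolding unit_poly_def sum_distrib_right using x by (intro cong_sum vertex_generator)
  then show "unit_poly * var x \<approx> var x"
    using x by (simp only: sum_single_vertex generator_ends_verts)
  have "var x * unit_poly \<approx> (\<Sum>v\<in>verts G. if v = generator_range x then var x else 0)"
    unfolding unit_poly_def sum_distrib_left using x by (intro cong_sum generator_vertex)
  then show "var x * unit_poly \<approx> var x"
    using x by (simp only: sum_single_vertex generator_ends_verts)
qed

definition nonunital_polys :: "(('a, 'b) generator list \<Rightarrow>\<^sub>0 'k::field) set" where
  "nonunital_polys = {f \<in> polys. Poly_Mapping.lookup f [] = 0}"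

lemma nonunital_polys_iff:
  "f \<in> nonunital_polys \<longleftrightarrow> Poly_Mapping.keys f \<subseteq> lists (generators G) - {[]}"
  by (auto simp: nonunital_polys_def polys_iff in_keys_iff)

lemma nonunital_polys_polys: "f \<in> nonunital_polys \<Longrightarrow> f \<in> polys"
  by (simp add: nonunital_polys_def)

lemma nonunital_zero [simp]: "0 \<in> nonunital_polys"
  by (simp add: nonunital_polys_def)

lemma nonunital_add [simp]: "\<lbrakk>f \<in> nonunital_polys; g \<in> nonunital_polys\<rbrakk> \<Longrightarrow> f + g \<in> nonunital_polys"
  by (simp add: nonunital_polys_def lookup_add)

lemma nonunital_uminus [simp]: "f \<in> nonunital_polys \<Longrightarrow> - f \<in> nonunital_polys"
  by (simp add: nonunital_polys_def)

lemma nonunital_sum [simp]: "(\<And>i. i \<in> A \<Longrightarrow> f i \<in> nonunital_polys) \<Longrightarrow> (\<Sum>i\<in>A. f i) \<in> nonunital_polys"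
  by (induction A rule: infinite_finite_induct) auto

lemma nonunital_var [simp]: "x \<in> generators G \<Longrightarrow> Poly_Mapping.single [x] a \<in> nonunital_polys"
  by (auto simp: nonunital_polys_iff)

lemma lookup_mult_Nil: "Poly_Mapping.lookup (f * g) [] = Poly_Mapping.lookup f [] * Poly_Mapping.lookup g []"
  for f g :: "'x list \<Rightarrow>\<^sub>0 'k::field"
proof (induction f rule: poly_mapping_induct)
  case (monomial w a)
  show ?case
  proof (induction g rule: poly_mapping_induct)
    case (monomial v b)
    show ?case by (simp add: single_mult_single lookup_single when_def)
  qed (simp_all add: lookup_add distrib_left)
qed (simp_all add: lookup_add distrib_right)

lemma nonunital_mult:
  "\<lbrakk>f \<in> nonunital_polys; g \<in> polys\<rbrakk> \<Longrightarrow> f * g \<in> nonunital_polys"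
  "\<lbrakk>f \<in> polys; g \<in> nonunital_polys\<rbrakk> \<Longrightarrow> f * g \<in> nonunital_polys"
  by (simp_all add: nonunital_polys_def lookup_mult_Nil)

lemma unit_poly_nonunital [simp]: "unit_poly \<in> nonunital_polys"
  by (simp add: unit_poly_def)

lemma unit_left:
  assumes "f \<in> nonunital_polys"
  shows "unit_poly * f \<approx> f"
  using assms[unfolded nonunital_polys_iff]
proof (induction f rule: poly_mapping_monomial_induct)
  case (monomial w a)
  then obtain x v where w: "w = [x] @ v" "x \<in> generators G" "v \<in> lists (generators G)"
    by (cases w) auto
  have eq: "Poly_Mapping.single w a = var x * Poly_Mapping.single v a"
    by (simp add: single_mult_single w)
  show ?case unfolding eq mult.assoc[symmetric]
    using w by (intro cong_right unit_generator) auto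
qed (auto simp: distrib_left intro: cong_add)

lemma unit_right:
  assumes "f \<in> nonunital_polys"
  shows "f * unit_poly \<approx> f"
  using assms[unfolded nonunital_polys_iff]
proof (induction f rule: poly_mapping_monomial_induct)
  case (monomial w a)
  then obtain x v where w: "w = v @ [x]" "x \<in> generators G" "v \<in> lists (generators G)"
    by (cases w rule: rev_cases) auto
  have eq: "Poly_Mapping.single w a = Poly_Mapping.single v a * var x"
    by (simp add: single_mult_single w)
  show ?case unfolding eq mult.assoc
    using w by (intro cong_left unit_generator) auto
qed (auto simp: distrib_right intro: cong_add)

definition central :: "(('a, 'b) generator list \<Rightarrow>\<^sub>0 'k::field) \<Rightarrow> bool" where
  "central z \<longleftrightarrow> z \<in> polys \<and> (\<forall>x \<in> generators G. z * var x \<approx> var x * z)"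

lemma central_polys: "central z \<Longrightarrow> z \<in> polys"
  by (simp add: central_def)

lemma central_commute:
  assumes z: "central z" and f: "f \<in> polys"
  shows "z * f \<approx> f * z"
  using f[unfolded polys_iff]
proof (induction f rule: poly_mapping_monomial_induct)
  case (monomial w a)
  then show ?case
  proof (induction w)
    case Nil
    show ?case by (simp add: single_Nil_commute)
  next
    case (Cons x w)
    note zp = central_polys[OF z]
    have eq: "Poly_Mapping.single (x # w) a = var x * Poly_Mapping.single w a"
      by (simp add: single_mult_single)
    have "z * var x * Poly_Mapping.single w a \<approx> var x * z * Poly_Mapping.single w a"
      using z Cons by (intro cong_right) (auto simp: central_def)
    also have "\<dots> = var x * (z * Poly_Mapping.single w a)" by (simp add: mult.assoc)
    also have "\<dots> \<approx> var x * (Poly_Mapping.single w a * z)"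
      using Cons by (intro cong_left) auto
    finally show ?case by (simp add: eq mult.assoc)
  qed
qed (auto simp: distrib_left distrib_right intro: cong_add)

end

section \<open>Central elements of degree zero at persistent vertices\<close>

lemma word_degree_ge: "- int (length w) \<le> word_degree w"
proof (induction w)
  case (Cons x w)
  then show ?case by (cases x) auto
qed simp

context fin_digraph
begin

text \<open>
  Including the final vertex as a letter makes the path of length zero at \<open>v\<close> the vertex \<open>v\<close>.
  The second polynomial is the formal adjoint of the first.
\<close>

definition path_poly :: "'b list \<Rightarrow> 'a \<Rightarrow> ('a, 'b) generator list \<Rightarrow>\<^sub>0 'k::field" where
  "path_poly p v = Poly_Mapping.single (map Edge p @ [Vertex v]) 1"

definition ghost_poly :: "'b list \<Rightarrow> 'a \<Rightarrow> ('a, 'b) generator list \<Rightarrow>\<^sub>0 'k::field" where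
  "ghost_poly p v = Poly_Mapping.single (Vertex v # map Ghost (rev p)) 1"

lemma path_poly_simps [simp]:
  "path_poly [] v = vx v"
  "path_poly (e # p) v = ed e * path_poly p v"
  by (simp_all add: path_poly_def single_mult_single)

lemma ghost_poly_simps [simp]:
  "ghost_poly [] v = vx v"
  "ghost_poly (e # p) v = ghost_poly p v * gh e"
  by (simp_all add: ghost_poly_def single_mult_single)

lemma walk_polys:
  assumes "awalk u p v"
  shows "path_poly p v \<in> polys" "ghost_poly p v \<in> polys"
proof -
  have "\<forall>e \<in> set p. e \<in> arcs G" "v \<in> verts G" using assms awalk_last_in_verts by (auto elim: awalkE)
  then show "path_poly p v \<in> polys" "ghost_poly p v \<in> polys"
    unfolding path_poly_def ghost_poly_def by (auto intro!: polys_single simp: in_lists_conv_set)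
qed

lemma vertex_path:
  assumes p: "awalk u p v" and w: "w \<in> verts G"
  shows "(vx w :: _ \<Rightarrow>\<^sub>0 'k::field) * path_poly p v \<approx> (if w = u then path_poly p v else 0)"
proof (cases p)
  case Nil
  have "(vx w :: _ \<Rightarrow>\<^sub>0 'k) * vx v \<approx> (if w = v then vx w else 0)"
    using p w Nil by (intro vertex_vertex) (auto simp: awalk_simps)
  then show ?thesis using p Nil by (auto simp: awalk_simps)
next
  case (Cons e q)
  have e: "e \<in> arcs G" "u = tail G e" "awalk (head G e) q v"
    using p Cons by (auto simp: awalk_simps)
  have "(vx w * ed e) * (path_poly q v :: _ \<Rightarrow>\<^sub>0 'k) \<approx> (if w = tail G e then ed e else 0) * path_poly q v"
    using w e by (intro cong_right vertex_edge walk_polys)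
  then show ?thesis using e Cons by (auto simp: mult.assoc)
qed

lemma ghost_path:
  assumes "awalk u p v" "awalk u' q v" "length p = length q"
  shows "ghost_poly p v * (path_poly q v :: _ \<Rightarrow>\<^sub>0 'k::field) \<approx> (if p = q then vx v else 0)"
  using assms
proof (induction p arbitrary: q u u')
  case Nil
  have "(vx v :: _ \<Rightarrow>\<^sub>0 'k) * vx v \<approx> (if v = v then vx v else 0)"
    using Nil awalk_last_in_verts by (intro vertex_vertex) auto
  then show ?case using Nil by simp
next
  case (Cons e p)
  then obtain f q' where q: "q = f # q'" by (cases q) auto
  have walks: "awalk (head G e) p v" "awalk (head G f) q' v" "e \<in> arcs G" "f \<in> arcs G"
    using Cons.prems q by (auto simp: awalk_simps)
  note carr [simp] = walk_polys[OF walks(1)] walk_polys[OF walks(2)]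
  let ?g = "ghost_poly p v :: _ \<Rightarrow>\<^sub>0 'k" and ?p = "path_poly q' v :: _ \<Rightarrow>\<^sub>0 'k"
  have "?g * ((gh e * ed f) * ?p) \<approx> ?g * ((if e = f then vx (head G e) else 0) * ?p)"
    using walks by (intro cong_left cong_right ghost_edge) auto
  also have "\<dots> \<approx> (if e # p = q then vx v else 0)"
  proof (cases "e = f")
    case True
    have "?g * (vx (head G e) * ?p) \<approx> ?g * (if head G e = head G f then ?p else 0)"
      using walks by (intro cong_left vertex_path) auto
    also have "\<dots> = ?g * ?p" using True by simp
    also have "\<dots> \<approx> (if p = q' then vx v else 0)"
      using Cons.prems q walks by (intro Cons.IH) auto
    finally show ?thesis using True q by simp
  qed (simp add: q)
  finally show ?case by (simp add: q mult.assoc)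
qed

text \<open>
  A ghost edge can be cancelled against the first edge of a path. Without a first edge
  the path is a vertex \<open>v\<close>, and if \<open>v\<close> is a sink then the ghost of any edge kills it since no
  edge starts there.
\<close>

lemma generator_path:
  assumes x: "x \<in> generators G" and p: "awalk u p v" and long: "p \<noteq> [] \<or> out_arcs G v = {}"
  shows "var x * (path_poly p v :: _ \<Rightarrow>\<^sub>0 'k::field) \<approx> 0 \<or>
    (\<exists>u' q. awalk u' q v \<and> int (length q) = int (length p) + generator_degree x \<and>
       var x * (path_poly p v :: _ \<Rightarrow>\<^sub>0 'k) \<approx> path_poly q v)"
proof -
  let ?p = "\<lambda>p. path_poly p v :: _ \<Rightarrow>\<^sub>0 'k"
  note [simp] = walk_polys[OF p]
  show ?thesis
  proof (cases x)
    case (Vertex w)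
    have "var x * ?p p \<approx> (if w = u then ?p p else 0)"
      unfolding Vertex using x p Vertex by (intro vertex_path) auto
    then show ?thesis using p Vertex by (auto split: if_splits)
  next
    case (Edge e)
    then have e: "e \<in> arcs G" using x by simp
    show ?thesis
    proof (cases "head G e = u")
      case True
      then have "awalk (tail G e) (e # p) v" using p e by (auto simp: awalk_simps)
      then show ?thesis using Edge by (intro disjI2 exI[of _ "tail G e"] exI[of _ "e # p"]) auto
    next
      case False
      have "ed e * ?p p \<approx> (ed e * vx (head G e)) * ?p p"
        using e by (intro cong_right cong_sym[OF edge_head]) auto
      also have "\<dots> = ed e * (vx (head G e) * ?p p)" by (simp add: mult.assoc)
      also have "\<dots> \<approx> ed e * (if head G e = u then ?p p else 0)"
        using e p by (intro cong_left vertex_path) auto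
      finally show ?thesis using Edge False by simp
    qed
  next
    case (Ghost e)
    then have e: "e \<in> arcs G" using x by simp
    show ?thesis
    proof (cases p)
      case Nil
      with p long have v: "v \<in> verts G" "v \<noteq> tail G e" using e by (auto simp: awalk_simps out_arcs_def)
      have "(gh e :: _ \<Rightarrow>\<^sub>0 'k) * vx v \<approx> (if v = tail G e then gh e else 0)"
        using e v by (intro ghost_vertex)
      then show ?thesis using Ghost Nil v by simp
    next
      case (Cons f q)
      have f: "f \<in> arcs G" "awalk (head G f) q v" using p Cons by (auto simp: awalk_simps)
      note [simp] = walk_polys[OF f(2)]
      have "gh e * ?p p = (gh e * ed f) * ?p q" using Cons by (simp add: mult.assoc)
      also have "\<dots> \<approx> (if e = f then vx (head G e) else 0) * ?p q"
        using e f by (intro cong_right ghost_edge) auto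
      finally have *: "gh e * ?p p \<approx> (if e = f then vx (head G e) else 0) * ?p q" .
      show ?thesis
      proof (cases "e = f")
        case True
        note *
        also have "(if e = f then vx (head G e) else 0) * ?p q \<approx> (if head G e = head G f then ?p q else 0)"
          using e f True vertex_path[OF f(2), of "head G e"] by simp
        finally have "var x * ?p p \<approx> ?p q" using True Ghost by simp
        then show ?thesis using f Ghost Cons
          by (intro disjI2 exI[of _ "head G f"] exI[of _ q]) simp
      qed (use * Ghost in simp)
    qed
  qed
qed

text \<open>
  Every letter of \<open>w\<close> shortens the path by at most one edge. Hence a path at least as long as
  \<open>w\<close> never runs out while it absorbs \<open>w\<close>.
\<close>

lemma word_path:
  assumes "w \<in> lists (generators G)" and p: "awalk u p v"
    and "length w \<le> length p \<or> out_arcs G v = {}"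
  shows "Poly_Mapping.single w 1 * (path_poly p v :: _ \<Rightarrow>\<^sub>0 'k::field) \<approx> 0 \<or>
    (\<exists>u' q. awalk u' q v \<and> int (length q) = int (length p) + word_degree w \<and>
       Poly_Mapping.single w 1 * (path_poly p v :: _ \<Rightarrow>\<^sub>0 'k) \<approx> path_poly q v)"
  using assms(1,3)
proof (induction w)
  case Nil
  show ?case using p by (intro disjI2 exI[of _ u] exI[of _ p]) simp
next
  case (Cons x w)
  let ?p = "\<lambda>p. path_poly p v :: _ \<Rightarrow>\<^sub>0 'k"
  have x: "x \<in> generators G" using Cons by simp
  have eq: "Poly_Mapping.single (x # w) 1 * ?p p = var x * (Poly_Mapping.single w 1 * ?p p)"
    by (simp add: single_mult_single mult.assoc[symmetric])
  have IH: "Poly_Mapping.single w 1 * ?p p \<approx> 0 \<or>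
    (\<exists>u' q. awalk u' q v \<and> int (length q) = int (length p) + word_degree w \<and>
       Poly_Mapping.single w 1 * ?p p \<approx> ?p q)"
    using Cons by auto
  then show ?case
  proof
    assume "Poly_Mapping.single w 1 * ?p p \<approx> 0"
    then have "var x * (Poly_Mapping.single w 1 * ?p p) \<approx> 0"
      using x by - (rule cong_zero_left, auto)
    then show ?thesis unfolding eq by simp
  next
    assume "\<exists>u' q. awalk u' q v \<and> int (length q) = int (length p) + word_degree w \<and>
       Poly_Mapping.single w 1 * ?p p \<approx> ?p q"
    then obtain u' q where q: "awalk u' q v" "int (length q) = int (length p) + word_degree w"
      and cong: "Poly_Mapping.single w 1 * ?p p \<approx> ?p q" by auto
    have step: "var x * (Poly_Mapping.single w 1 * ?p p) \<approx> var x * ?p q"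
      using x by (intro cong_left[OF cong]) auto
    have "q \<noteq> [] \<or> out_arcs G v = {}" using Cons.prems q(2) word_degree_ge[of w] by auto
    from generator_path[OF x q(1) this, where 'k='k] show ?thesis
    proof
      assume "var x * ?p q \<approx> 0"
      then show ?thesis unfolding eq using cong_trans[OF step] by blast
    next
      assume "\<exists>u'' q'. awalk u'' q' v \<and> int (length q') = int (length q) + generator_degree x \<and>
        var x * ?p q \<approx> ?p q'"
      then obtain u'' q' where "awalk u'' q' v" "int (length q') = int (length q) + generator_degree x"
        "var x * ?p q \<approx> ?p q'" by auto
      then show ?thesis unfolding eq using cong_trans[OF step] q(2) by fastforce
    qed
  qed
qed

text \<open>
  The vertices at which a central element of degree zero is bound to act as a scalar. In a finite
  graph the second alternative means that \<open>v\<close> can be reached from a cycle.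
\<close>

definition persistent :: "'a \<Rightarrow> bool" where
  "persistent v \<longleftrightarrow> v \<in> verts G \<and>
     (out_arcs G v = {} \<or> (\<forall>n. \<exists>u p. awalk u p v \<and> n \<le> length p))"

lemma persistent_verts: "persistent v \<Longrightarrow> v \<in> verts G"
  by (simp add: persistent_def)

lemma persistent_head:
  assumes e: "e \<in> arcs G" and p: "persistent (tail G e)"
  shows "persistent (head G e)"
proof -
  have "\<exists>u p. awalk u p (head G e) \<and> n \<le> length p" for n
  proof -
    have "out_arcs G (tail G e) \<noteq> {}" using e by (auto simp: out_arcs_def)
    then obtain u p where "awalk u p (tail G e)" "n \<le> length p"
      using p unfolding persistent_def by blast
    then have "awalk u (p @ [e]) (head G e)" "n \<le> length (p @ [e])"
      using awalk_appendI[OF _ arc_implies_awalk[OF e]] by auto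
    then show ?thesis by blast
  qed
  then show ?thesis using e by (auto simp: persistent_def)
qed

text \<open>
  Choose a path \<open>p\<close> ending at \<open>v\<close> that is at least as long as all words in \<open>z\<close>, or the trivial
  path if \<open>v\<close> is a sink. Each word of \<open>z\<close> has degree zero, so it turns \<open>p\<close> into zero or into
  a path of the same length ending at \<open>v\<close>; multiplication by the adjoint of \<open>p\<close> leaves \<open>v\<close> or zero.
  Thus \<open>p\<^sup>* z p\<close> is a multiple of \<open>v\<close>. As \<open>z\<close> is central, it also equals \<open>z p\<^sup>* p = z v\<close>.
\<close>

lemma central_scalar_at_persistent:
  fixes z :: "_ \<Rightarrow>\<^sub>0 'k::field"
  assumes z: "central z" "of_degree 0 z" and v: "persistent v"
  shows "\<exists>k. z * vx v \<approx> Poly_Mapping.single [] k * vx v"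
proof -
  obtain n where n: "\<And>w. w \<in> Poly_Mapping.keys z \<Longrightarrow> length w \<le> n"
    using finite_nat_set_iff_bounded_le[of "length ` Poly_Mapping.keys z"] by auto
  obtain u p where p: "awalk u p v" and long: "n \<le> length p \<or> out_arcs G v = {}"
    using v awalk_Nil_iff[of v v] unfolding persistent_def by blast
  let ?p = "path_poly p v :: _ \<Rightarrow>\<^sub>0 'k" and ?g = "ghost_poly p v :: _ \<Rightarrow>\<^sub>0 'k"
  let ?c = "\<lambda>k. Poly_Mapping.single [] k :: ('a, 'b) generator list \<Rightarrow>\<^sub>0 'k"
  note [simp] = walk_polys[OF p] persistent_verts[OF v]
  note zp = central_polys[OF z(1)]
  have "\<exists>k. ?g * (f * ?p) \<approx> ?c k * vx v" if "Poly_Mapping.keys f \<subseteq> Poly_Mapping.keys z" for f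
    using that
  proof (induction f rule: poly_mapping_monomial_induct)
    case zero
    show ?case by (intro exI[of _ 0]) simp
  next
    case (monomial w a)
    have w: "w \<in> lists (generators G)" "word_degree w = 0"
      using monomial zp z(2) by (auto simp: polys_iff of_degree_def)
    have len: "length w \<le> length p \<or> out_arcs G v = {}" using long n[OF monomial] by auto
    have "\<exists>k. ?g * (Poly_Mapping.single w 1 * ?p) \<approx> ?c k * vx v"
      using word_path[OF w(1) p len, where 'k='k]
    proof
      assume "Poly_Mapping.single w 1 * ?p \<approx> 0"
      then have "?g * (Poly_Mapping.single w 1 * ?p) \<approx> 0" by - (rule cong_zero_left, auto)
      then show ?thesis by (intro exI[of _ 0]) simp
    next
      assume "\<exists>u' q. awalk u' q v \<and> int (length q) = int (length p) + word_degree w \<and>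
        Poly_Mapping.single w 1 * ?p \<approx> path_poly q v"
      then obtain u' q where q: "awalk u' q v" "length q = length p"
        and cong: "Poly_Mapping.single w 1 * ?p \<approx> path_poly q v" using w(2) by auto
      have "?g * (Poly_Mapping.single w 1 * ?p) \<approx> ?g * path_poly q v"
        using cong by (rule cong_left) simp
      also have "\<dots> \<approx> (if p = q then vx v else 0)" using p q by (intro ghost_path) auto
      also have "\<dots> = ?c (if p = q then 1 else 0) * vx v" by simp
      finally show ?thesis ..
    qed
    then obtain k where k: "?g * (Poly_Mapping.single w 1 * ?p) \<approx> ?c k * vx v" ..
    have "?g * (Poly_Mapping.single w a * ?p) = ?g * ?c a * (Poly_Mapping.single w 1 * ?p)"
      by (simp add: mult.assoc) (simp add: mult.assoc[symmetric] single_mult_single)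
    also have "\<dots> = ?c a * (?g * (Poly_Mapping.single w 1 * ?p))"
      by (simp add: single_Nil_commute mult.assoc)
    also have "\<dots> \<approx> ?c a * (?c k * vx v)" using k by (rule cong_left) simp
    also have "\<dots> = ?c (a * k) * vx v" by (simp add: mult.assoc[symmetric] single_mult_single)
    finally show ?case ..
  next
    case (add f g)
    then obtain k l where "?g * (f * ?p) \<approx> ?c k * vx v" "?g * (g * ?p) \<approx> ?c l * vx v" by auto
    then have "?g * (f * ?p) + ?g * (g * ?p) \<approx> ?c k * vx v + ?c l * vx v" by (rule cong_add)
    then show ?case
      by (intro exI[of _ "k + l"]) (simp only: distrib_left distrib_right single_add)
  qed
  then obtain k where k: "?g * (z * ?p) \<approx> ?c k * vx v" by auto
  have "z * vx v \<approx> z * (if p = p then vx v else 0)" by simp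
  also have "\<dots> \<approx> z * (?g * ?p)"
    using p zp by (intro cong_left cong_sym[OF ghost_path]) auto
  also have "\<dots> = (z * ?g) * ?p" by (simp add: mult.assoc)
  also have "\<dots> \<approx> (?g * z) * ?p" by (intro cong_right central_commute[OF z(1)]) auto
  also have "\<dots> = ?g * (z * ?p)" by (simp add: mult.assoc)
  also note k
  finally show ?thesis by blast
qed

text \<open>
  Induction against the edges, starting from the persistent vertices. It terminates because
  the paths that end in a vertex that is not persistent have length at most some \<open>N\<close>: the
  inner induction is on how much the length of a path to the vertex falls short of \<open>N\<close>.
\<close>

lemma forward_induct [consumes 1, case_names persistent step]:
  assumes v: "v \<in> verts G"
    and persistent: "\<And>v. persistent v \<Longrightarrow> Q v"
    and step: "\<And>v. \<lbrakk>v \<in> verts G; \<not> persistent v; out_arcs G v \<noteq> {}; \<And>e. e \<in> out_arcs G v \<Longrightarrow> Q (head G e)\<rbrakk> \<Longrightarrow> Q v"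
  shows "Q v"
proof -
  have "\<forall>v \<in> {v \<in> verts G. \<not> persistent v}. \<exists>n. \<forall>u p. awalk u p v \<longrightarrow> length p < n"
    unfolding persistent_def by (auto simp: not_le)
  then obtain n where n: "\<And>v u p. \<lbrakk>v \<in> verts G; \<not> persistent v; awalk u p v\<rbrakk> \<Longrightarrow> length p < n v"
    by (metis (mono_tags, lifting) mem_Collect_eq)
  obtain N where N: "\<And>v. v \<in> verts G \<Longrightarrow> n v \<le> N"
    using finite_nat_set_iff_bounded_le[of "n ` verts G"] by auto
  have "Q v" if "awalk u p v" "N \<le> length p + j" for u p v j
    using that
  proof (induction j arbitrary: u p v)
    case 0
    then have "v \<in> verts G" by auto
    with 0 have "persistent v" using n[of v u p] N[of v] by fastforce
    then show ?case by (rule persistent)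
  next
    case (Suc j)
    then have v: "v \<in> verts G" by auto
    show ?case
    proof (cases "persistent v")
      case False
      have "Q (head G e)" if "e \<in> out_arcs G v" for e
      proof (rule Suc.IH)
        show "awalk u (p @ [e]) (head G e)"
          using awalk_appendI[OF Suc.prems(1)] arc_implies_awalk[of e] that by auto
      qed (use Suc.prems in auto)
      moreover have "out_arcs G v \<noteq> {}" using False v by (auto simp: persistent_def)
      ultimately show ?thesis using step False v by blast
    qed (rule persistent)
  qed
  from this[of v "[]" v N] show ?thesis using v by (simp add: awalk_Nil_iff)
qed

text \<open>
  At a vertex \<open>v\<close> that is not persistent, and hence not a sink, \<open>v\<close> is the sum of the \<open>e e\<^sup>*\<close> over
  its outgoing edges, and \<open>x e e\<^sup>* = e (x r(e)) e\<^sup>*\<close> reduces the claim to the ranges \<open>r(e)\<close>.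
\<close>

lemma central_eq_zero:
  fixes x :: "_ \<Rightarrow>\<^sub>0 'k::field"
  assumes x: "central x" "x \<in> nonunital_polys" and zero: "\<And>v. persistent v \<Longrightarrow> x * vx v \<approx> 0"
  shows "x \<approx> 0"
proof -
  note xp [simp] = central_polys[OF x(1)]
  have "x * vx v \<approx> 0" if "v \<in> verts G" for v
    using that
  proof (induction v rule: forward_induct)
    case (step v)
    have "x * (ed e * gh e) \<approx> 0" if e: "e \<in> out_arcs G v" for e
    proof -
      have [simp]: "e \<in> arcs G" using e by simp
      have "x * (ed e * gh e) = (x * ed e) * gh e" by (simp add: mult.assoc)
      also have "\<dots> \<approx> (x * (ed e * vx (head G e))) * gh e"
        by (intro cong_right cong_left cong_sym[OF edge_head]) auto
      also have "\<dots> = (x * ed e) * (vx (head G e) * gh e)" by (simp add: mult.assoc)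
      also have "\<dots> \<approx> (ed e * x) * (vx (head G e) * gh e)"
        by (intro cong_right central_commute[OF x(1)]) auto
      also have "\<dots> = (ed e * (x * vx (head G e))) * gh e" by (simp add: mult.assoc)
      also have "\<dots> \<approx> (ed e * 0) * gh e"
        by (intro cong_right cong_left step.IH e) auto
      finally show ?thesis by simp
    qed
    then have "(\<Sum>e\<in>out_arcs G v. x * (ed e * gh e)) \<approx> (\<Sum>e\<in>out_arcs G v. 0)" by (rule cong_sum)
    moreover have "x * vx v \<approx> x * (\<Sum>e\<in>out_arcs G v. ed e * gh e)"
      using step by (intro cong_left cong_sym[OF sum_edge_ghost]) auto
    ultimately show ?case by (simp add: sum_distrib_left cong_trans)
  qed (rule zero)
  then have "(\<Sum>v\<in>verts G. x * vx v) \<approx> (\<Sum>v\<in>verts G. 0)" by (rule cong_sum)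
  then have "x * unit_poly \<approx> 0" by (simp add: unit_poly_def sum_distrib_left)
  then show ?thesis using cong_trans[OF cong_sym[OF unit_right[OF x(2)]]] by blast
qed

lemma central_diff: "\<lbrakk>central x; central y\<rbrakk> \<Longrightarrow> central (x - y)"
  by (auto simp: central_def left_diff_distrib right_diff_distrib intro: cong_diff)

lemma central_sum: "(\<And>i. i \<in> A \<Longrightarrow> central (f i)) \<Longrightarrow> central (\<Sum>i\<in>A. f i)"
  by (auto simp: central_def sum_distrib_left sum_distrib_right intro: cong_sum)

lemma central_mult:
  assumes "central x" "central y"
  shows "central (x * y)"
proof -
  note [simp] = assms[THEN central_polys]
  have "x * y * var g \<approx> var g * (x * y)" if g: "g \<in> generators G" for g
  proof -
    have "x * y * var g = x * (y * var g)" by (simp add: mult.assoc)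
    also have "\<dots> \<approx> x * (var g * y)" using assms g by (intro cong_left) (auto simp: central_def)
    also have "\<dots> = (x * var g) * y" by (simp add: mult.assoc)
    also have "\<dots> \<approx> (var g * x) * y" using assms g by (intro cong_right) (auto simp: central_def)
    finally show ?thesis by (simp add: mult.assoc)
  qed
  then show ?thesis by (simp add: central_def)
qed

lemma central_unit_poly: "central unit_poly"
  by (auto simp: central_def intro: cong_trans[OF unit_generator(1) cong_sym[OF unit_generator(2)]])

lemma central_scalar: "central (Poly_Mapping.single [] k)"
  by (simp add: central_def single_Nil_commute)

end

section \<open>Blocks and their idempotents\<close>

context fin_digraph
begin

text \<open>
  The component at \<open>v\<close> of the idempotent belonging to a set \<open>C\<close> of persistent vertices. The
  idempotent has to be \<open>v\<close> or zero at a persistent vertex, and at any other vertex it is determined by its components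
  at the ranges of the outgoing edges. This recursion runs along the edges and is
  cut off after \<open>j\<close> steps; \<open>spread_stable\<close> shows that large \<open>j\<close> give a solution
  of the recursion without cut-off. The value for \<open>j = 0\<close> matters at persistent vertices only.
\<close>

primrec spread :: "'a set \<Rightarrow> nat \<Rightarrow> 'a \<Rightarrow> ('a, 'b) generator list \<Rightarrow>\<^sub>0 'k::field" where
  "spread C 0 v = (if v \<in> C then vx v else 0)"
| "spread C (Suc j) v =
     (if persistent v then if v \<in> C then vx v else 0
      else \<Sum>e\<in>out_arcs G v. ed e * spread C j (head G e) * gh e)"

lemma spread_persistent: "persistent v \<Longrightarrow> spread C j v = (if v \<in> C then vx v else 0)"
  by (cases j) auto

lemma spread_nonunital: "v \<in> verts G \<Longrightarrow> spread C j v \<in> nonunital_polys"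
proof (induction j arbitrary: v)
  case (Suc j)
  then show ?case
    by (auto intro!: nonunital_sum nonunital_mult(2) nonunital_mult(1) nonunital_polys_polys)
qed auto

lemma spread_degree: "of_degree 0 (spread C j v)"
proof (induction j arbitrary: v)
  case (Suc j)
  have "of_degree (1 + 0 + - 1) (ed e * spread C j (head G e) * gh e :: _ \<Rightarrow>\<^sub>0 'c)" for e
    by (intro of_degree_mult Suc of_degree_single) simp_all
  then show ?case by (auto intro!: of_degree_sum of_degree_single)
qed (auto intro: of_degree_single)

text \<open>
  All coefficients of these polynomials are natural numbers.
\<close>

lemma spread_map:
  assumes "field_automorphism \<sigma>"
  shows "Poly_Mapping.map \<sigma> (spread C j v) = spread C j v"
proof -
  interpret field_automorphism \<sigma> by fact
  show ?thesis
    by (induction j arbitrary: v) (simp_all add: map_var map_sum map_mult del: map_single)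
qed

lemma spread_vertex:
  assumes "v \<in> verts G" "w \<in> verts G"
  shows "vx w * (spread C j v :: _ \<Rightarrow>\<^sub>0 'k::field) \<approx> (if w = v then spread C j v else 0)"
    and "(spread C j v :: _ \<Rightarrow>\<^sub>0 'k) * vx w \<approx> (if w = v then spread C j v else 0)"
proof -
  have vertex: "(vx w :: _ \<Rightarrow>\<^sub>0 'k) * vx v \<approx> (if w = v then vx w else 0)"
    "(vx v :: _ \<Rightarrow>\<^sub>0 'k) * vx w \<approx> (if v = w then vx v else 0)"
    using assms by (simp_all only: vertex_vertex)
  have left: "vx w * (\<Sum>e\<in>out_arcs G v. ed e * spread C i (head G e) * gh e)
      \<approx> (\<Sum>e\<in>out_arcs G v. if w = v then ed e * spread C i (head G e) * gh e else (0 :: _ \<Rightarrow>\<^sub>0 'k))" for i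
    unfolding sum_distrib_left
  proof (rule cong_sum)
    fix e assume e: "e \<in> out_arcs G v"
    let ?z = "spread C i (head G e) :: _ \<Rightarrow>\<^sub>0 'k"
    have [simp]: "e \<in> arcs G" "?z \<in> polys"
      using e by (auto intro: nonunital_polys_polys[OF spread_nonunital])
    have "vx w * (ed e * ?z * gh e) = (vx w * ed e) * (?z * gh e)" by (simp add: mult.assoc)
    also have "\<dots> \<approx> (if w = tail G e then ed e else 0) * (?z * gh e)"
      using assms by (intro cong_right vertex_edge) auto
    finally show "vx w * (ed e * ?z * gh e) \<approx> (if w = v then ed e * ?z * gh e else 0)"
      using e by (auto simp: mult.assoc split: if_splits)
  qed
  have right: "(\<Sum>e\<in>out_arcs G v. ed e * spread C i (head G e) * gh e) * vx w
      \<approx> (\<Sum>e\<in>out_arcs G v. if w = v then ed e * spread C i (head G e) * gh e else (0 :: _ \<Rightarrow>\<^sub>0 'k))" for i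
    unfolding sum_distrib_right
  proof (rule cong_sum)
    fix e assume e: "e \<in> out_arcs G v"
    let ?z = "spread C i (head G e) :: _ \<Rightarrow>\<^sub>0 'k"
    have [simp]: "e \<in> arcs G" "?z \<in> polys"
      using e by (auto intro: nonunital_polys_polys[OF spread_nonunital])
    have "(ed e * ?z * gh e) * vx w = (ed e * ?z) * (gh e * vx w)" by (simp add: mult.assoc)
    also have "\<dots> \<approx> (ed e * ?z) * (if w = tail G e then gh e else 0)"
      using assms by (intro cong_left ghost_vertex) auto
    finally show "(ed e * ?z * gh e) * vx w \<approx> (if w = v then ed e * ?z * gh e else 0)"
      using e by (auto split: if_splits)
  qed
  show "vx w * (spread C j v :: _ \<Rightarrow>\<^sub>0 'k) \<approx> (if w = v then spread C j v else 0)"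
  proof (cases j)
    case (Suc i)
    show ?thesis using vertex(1) left[of i] by (cases "w = v") (simp_all add: Suc)
  qed (use vertex(1) in \<open>cases "w = v"; simp\<close>)
  show "(spread C j v :: _ \<Rightarrow>\<^sub>0 'k) * vx w \<approx> (if w = v then spread C j v else 0)"
  proof (cases j)
    case (Suc i)
    show ?thesis using vertex(2) right[of i] by (cases "w = v") (simp_all add: Suc)
  qed (use vertex(2) in \<open>cases "w = v"; simp\<close>)
qed

lemma spread_eventually_constant:
  assumes "v \<in> verts G"
  shows "\<exists>z. \<forall>\<^sub>F j in sequentially. spread C j v = (z :: _ \<Rightarrow>\<^sub>0 'k::field)"
  using assms
proof (induction v rule: forward_induct)
  case (persistent v)
  then show ?case by (auto simp: spread_persistent)
next
  case (step v)
  then obtain z where "\<And>e. e \<in> out_arcs G v \<Longrightarrow>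
      \<forall>\<^sub>F j in sequentially. spread C j (head G e) = (z e :: _ \<Rightarrow>\<^sub>0 'k)"
    by metis
  then have "\<forall>\<^sub>F j in sequentially. \<forall>e\<in>out_arcs G v. spread C j (head G e) = z e"
    by (intro eventually_ball_finite) auto
  then have "\<forall>\<^sub>F j in sequentially. spread C (Suc j) v = (\<Sum>e\<in>out_arcs G v. ed e * z e * gh e)"
    by eventually_elim (simp add: step)
  then have "\<forall>\<^sub>F j in sequentially. spread C j v = (\<Sum>e\<in>out_arcs G v. ed e * z e * gh e)"
    by (subst (asm) eventually_sequentially_Suc)
  then show ?case ..
qed

lemma spread_stable:
  "\<exists>N. \<forall>v \<in> verts G. (spread C (Suc N) v :: _ \<Rightarrow>\<^sub>0 'k::field) = spread C N v"
proof -
  obtain z where "\<And>v. v \<in> verts G \<Longrightarrow> \<forall>\<^sub>F j in sequentially. spread C j v = (z v :: _ \<Rightarrow>\<^sub>0 'k)"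
    using spread_eventually_constant by metis
  then have "\<forall>\<^sub>F j in sequentially. \<forall>v \<in> verts G. spread C j v = z v"
    by (intro eventually_ball_finite) auto
  then obtain N where N: "\<And>j v. \<lbrakk>N \<le> j; v \<in> verts G\<rbrakk> \<Longrightarrow> spread C j v = z v"
    unfolding eventually_sequentially by blast
  have "\<forall>v \<in> verts G. (spread C (Suc N) v :: _ \<Rightarrow>\<^sub>0 'k) = spread C N v"
    using N[of "Suc N"] N[of N] by (simp del: spread.simps)
  then show ?thesis by blast
qed

text \<open>
  The sum \<open>x\<close> of the components \<open>z v\<close> is the required element. It commutes with a vertex \<open>w\<close>
  because both products are \<open>z w\<close>. It commutes with an edge \<open>a\<close> from \<open>u\<close> to \<open>w\<close> if
  \<open>z u a = a z w\<close>: for persistent \<open>u\<close> this holds since \<open>C\<close> contains both ends of \<open>a\<close> or neither,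
  and otherwise the recursion for \<open>z u\<close> is made to yield \<open>z u a = a z w a\<^sup>* a\<close>. Edges
  whose range vanishes in the algebra are exempt from the closure condition on \<open>C\<close>, as they are then zero as well.
\<close>

lemma block_idempotent_exists:
  assumes closed: "\<And>e. \<lbrakk>e \<in> arcs G; persistent (tail G e); \<not> (vx (head G e) :: _ \<Rightarrow>\<^sub>0 'k::field) \<approx> 0\<rbrakk>
      \<Longrightarrow> tail G e \<in> C \<longleftrightarrow> head G e \<in> C"
  shows "\<exists>x :: _ \<Rightarrow>\<^sub>0 'k. x \<in> nonunital_polys \<and> of_degree 0 x \<and> central x \<and>
    (\<forall>\<sigma>. field_automorphism \<sigma> \<longrightarrow> Poly_Mapping.map \<sigma> x = x) \<and>
    (\<forall>v. persistent v \<longrightarrow> x * vx v \<approx> (if v \<in> C then vx v else 0))"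
proof -
  obtain N where N: "\<And>v. v \<in> verts G \<Longrightarrow> (spread C (Suc N) v :: _ \<Rightarrow>\<^sub>0 'k) = spread C N v"
    using spread_stable by metis
  define z where "z v = (spread C N v :: _ \<Rightarrow>\<^sub>0 'k)" for v
  have z_persistent: "z v = (if v \<in> C then vx v else 0)" if "persistent v" for v
    using that by (simp add: z_def spread_persistent)
  have z_step: "z v = (\<Sum>e\<in>out_arcs G v. ed e * z (head G e) * gh e)"
    if "v \<in> verts G" "\<not> persistent v" for v
    using N[OF that(1)] that by (simp add: z_def)
  have z_nonunital: "z v \<in> nonunital_polys" if "v \<in> verts G" for v
    using that by (simp add: z_def spread_nonunital)
  have z_polys [simp]: "z v \<in> polys" if "v \<in> verts G" for v
    using z_nonunital[OF that] by (rule nonunital_polys_polys)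
  have z_vertex: "vx w * z v \<approx> (if w = v then z v else 0)" "z v * vx w \<approx> (if w = v then z v else 0)"
    if "v \<in> verts G" "w \<in> verts G" for v w
    unfolding z_def using that by (rule spread_vertex)+
  define x where "x = (\<Sum>v\<in>verts G. z v)"
  have x_polys [simp]: "x \<in> polys" by (simp add: x_def)
  have x_right: "x * vx w \<approx> z w" if w: "w \<in> verts G" for w
  proof -
    have "x * vx w \<approx> (\<Sum>v\<in>verts G. if v = w then z w else 0)"
      unfolding x_def sum_distrib_right
    proof (rule cong_sum)
      fix v assume "v \<in> verts G"
      then show "z v * vx w \<approx> (if v = w then z w else 0)"
        using z_vertex(2)[of v w] w by (auto split: if_splits)
    qed
    then show ?thesis using w by (simp only: sum_single_vertex)
  qed
  have x_left: "vx w * x \<approx> z w" if w: "w \<in> verts G" for w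
  proof -
    have "vx w * x \<approx> (\<Sum>v\<in>verts G. if v = w then z w else 0)"
      unfolding x_def sum_distrib_left
    proof (rule cong_sum)
      fix v assume "v \<in> verts G"
      then show "vx w * z v \<approx> (if v = w then z w else 0)"
        using z_vertex(1)[of v w] w by (auto split: if_splits)
    qed
    then show ?thesis using w by (simp only: sum_single_vertex)
  qed
  have z_edge: "z (tail G a) * ed a \<approx> ed a * z (head G a) \<and> gh a * z (tail G a) \<approx> z (head G a) * gh a"
    if a [simp]: "a \<in> arcs G" for a
  proof (cases "persistent (tail G a)")
    case True
    then have head: "persistent (head G a)" using a by (intro persistent_head)
    let ?v = "vx :: _ \<Rightarrow> _ \<Rightarrow>\<^sub>0 'k"
    show ?thesis
    proof (cases "?v (head G a) \<approx> 0")
      case True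
      have "ed a \<approx> ed a * ?v (head G a)" by (intro cong_sym[OF edge_head]) auto
      also have "\<dots> \<approx> 0" using True by - (rule cong_zero_left, auto)
      finally have ed0: "(ed a :: _ \<Rightarrow>\<^sub>0 'k) \<approx> 0" .
      have "gh a \<approx> ?v (head G a) * gh a" by (intro cong_sym[OF head_ghost]) auto
      also have "\<dots> \<approx> 0" using True by - (rule cong_zero_right, auto)
      finally have gh0: "(gh a :: _ \<Rightarrow>\<^sub>0 'k) \<approx> 0" .
      have "z (tail G a) * ed a \<approx> 0" "ed a * z (head G a) \<approx> 0"
        "gh a * z (tail G a) \<approx> 0" "z (head G a) * gh a \<approx> 0"
        using cong_zero_left[OF ed0] cong_zero_right[OF ed0] cong_zero_left[OF gh0] cong_zero_right[OF gh0]
        by simp_all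
      then show ?thesis using cong_trans[OF _ cong_sym] by blast
    next
      case False
      have ed: "?v (tail G a) * ed a \<approx> ed a * ?v (head G a)"
        by (rule cong_trans[OF tail_edge cong_sym[OF edge_head]]) auto
      have gh: "gh a * ?v (tail G a) \<approx> ?v (head G a) * gh a"
        by (rule cong_trans[OF ghost_tail cong_sym[OF head_ghost]]) auto
      show ?thesis
        using closed[OF a \<open>persistent (tail G a)\<close> False] ed gh
        by (simp add: z_persistent[OF \<open>persistent (tail G a)\<close>] z_persistent[OF head])
    qed
  next
    case False
    have step: "z (tail G a) = (\<Sum>b\<in>out_arcs G (tail G a). ed b * z (head G b) * gh b)"
      using False by (intro z_step) auto
    have delta: "(\<Sum>b\<in>out_arcs G (tail G a). if b = a then f else 0) = f" for f :: "_ \<Rightarrow>\<^sub>0 'k"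
      by (simp add: sum.delta[OF finite_out_arcs])
    have "z (tail G a) * ed a \<approx> (\<Sum>b\<in>out_arcs G (tail G a). if b = a then ed a * z (head G a) else 0)"
      unfolding step sum_distrib_right
    proof (rule cong_sum)
      fix b assume "b \<in> out_arcs G (tail G a)"
      then have [simp]: "b \<in> arcs G" by simp
      have "ed b * z (head G b) * gh b * ed a = (ed b * z (head G b)) * (gh b * ed a)"
        by (simp add: mult.assoc)
      also have "\<dots> \<approx> (ed b * z (head G b)) * (if b = a then vx (head G b) else 0)"
        by (intro cong_left ghost_edge) auto
      also have "\<dots> = ed b * (z (head G b) * (if b = a then vx (head G b) else 0))"
        by (simp add: mult.assoc)
      also have "\<dots> \<approx> (if b = a then ed a * z (head G a) else 0)"
        using cong_left[OF z_vertex(2)[of "head G a" "head G a"], of "ed a"] by simp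
      finally show "ed b * z (head G b) * gh b * ed a \<approx> (if b = a then ed a * z (head G a) else 0)" .
    qed
    moreover have "gh a * z (tail G a) \<approx> (\<Sum>b\<in>out_arcs G (tail G a). if b = a then z (head G a) * gh a else 0)"
      unfolding step sum_distrib_left
    proof (rule cong_sum)
      fix b assume "b \<in> out_arcs G (tail G a)"
      then have [simp]: "b \<in> arcs G" by simp
      have "gh a * (ed b * z (head G b) * gh b) = (gh a * ed b) * (z (head G b) * gh b)"
        by (simp add: mult.assoc)
      also have "\<dots> \<approx> (if a = b then vx (head G a) else 0) * (z (head G b) * gh b)"
        by (intro cong_right ghost_edge) auto
      also have "\<dots> = ((if a = b then vx (head G a) else 0) * z (head G b)) * gh b"
        by (simp add: mult.assoc)
      also have "\<dots> \<approx> (if b = a then z (head G a) * gh a else 0)"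
        using cong_right[OF z_vertex(1)[of "head G a" "head G a"], of "gh a"] by simp
      finally show "gh a * (ed b * z (head G b) * gh b) \<approx> (if b = a then z (head G a) * gh a else 0)" .
    qed
    ultimately show ?thesis by (simp only: delta)
  qed
  have "x * var g \<approx> var g * x" if g: "g \<in> generators G" for g
  proof (cases g)
    case (Vertex v)
    then show ?thesis using g cong_trans[OF x_right cong_sym[OF x_left]] by simp
  next
    case (Edge a)
    then have [simp]: "a \<in> arcs G" using g by simp
    have "x * ed a \<approx> x * (vx (tail G a) * ed a)" by (intro cong_left cong_sym[OF tail_edge]) auto
    also have "\<dots> = (x * vx (tail G a)) * ed a" by (simp add: mult.assoc)
    also have "\<dots> \<approx> z (tail G a) * ed a" by (intro cong_right x_right) auto
    also have "\<dots> \<approx> ed a * z (head G a)" using z_edge[of a] by simp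
    also have "\<dots> \<approx> ed a * (vx (head G a) * x)" by (intro cong_left cong_sym[OF x_left]) auto
    also have "\<dots> = (ed a * vx (head G a)) * x" by (simp add: mult.assoc)
    also have "\<dots> \<approx> ed a * x" by (intro cong_right edge_head) auto
    finally show ?thesis using Edge by simp
  next
    case (Ghost a)
    then have [simp]: "a \<in> arcs G" using g by simp
    have "x * gh a \<approx> x * (vx (head G a) * gh a)" by (intro cong_left cong_sym[OF head_ghost]) auto
    also have "\<dots> = (x * vx (head G a)) * gh a" by (simp add: mult.assoc)
    also have "\<dots> \<approx> z (head G a) * gh a" by (intro cong_right x_right) auto
    also have "\<dots> \<approx> gh a * z (tail G a)" using z_edge[of a] by (simp add: cong_sym)
    also have "\<dots> \<approx> gh a * (vx (tail G a) * x)" by (intro cong_left cong_sym[OF x_left]) auto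
    also have "\<dots> = (gh a * vx (tail G a)) * x" by (simp add: mult.assoc)
    also have "\<dots> \<approx> gh a * x" by (intro cong_right ghost_tail) auto
    finally show ?thesis using Ghost by simp
  qed
  then have "central x" by (simp add: central_def)
  moreover have "x \<in> nonunital_polys" by (simp add: x_def z_nonunital)
  moreover have "of_degree 0 x" by (simp add: x_def z_def of_degree_sum spread_degree)
  moreover have "Poly_Mapping.map \<sigma> x = x" if "field_automorphism \<sigma>" for \<sigma>
    using that by (simp add: x_def z_def field_automorphism.map_sum spread_map)
  moreover have "x * vx v \<approx> (if v \<in> C then vx v else 0)" if v: "persistent v" for v
    using x_right[OF persistent_verts[OF v]] by (simp only: z_persistent[OF v])
  ultimately show ?thesis by blast
qed

text \<open>
  The equivalence relation generated by the edges that start at a persistent vertex and do not end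
  in a vertex that is zero in the algebra. Hence no vertex of a block vanishes, and the scalar by
  which a central element acts on the block is determined by any one of its vertices.
\<close>

definition linked :: "'k::field itself \<Rightarrow> ('a \<times> 'a) set" where
  "linked K = (let R = {(tail G e, head G e) | e. e \<in> arcs G \<and> persistent (tail G e) \<and>
       \<not> (vx (head G e) :: _ \<Rightarrow>\<^sub>0 'k) \<approx> 0} in (R \<union> R\<inverse>)\<^sup>*)"

definition blocks :: "'k::field itself \<Rightarrow> 'a set set" where
  "blocks K = {linked K `` {v} | v. persistent v \<and> \<not> (vx v :: _ \<Rightarrow>\<^sub>0 'k) \<approx> 0}"

lemma linked_refl: "(v, v) \<in> linked K"
  by (simp add: linked_def Let_def)

lemma linked_sym: "(v, w) \<in> linked K \<Longrightarrow> (w, v) \<in> linked K"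
  unfolding linked_def Let_def
  by (rule symD[OF sym_rtrancl[OF sym_Un_converse]])

lemma linked_trans: "\<lbrakk>(u, v) \<in> linked K; (v, w) \<in> linked K\<rbrakk> \<Longrightarrow> (u, w) \<in> linked K"
  by (auto simp: linked_def Let_def)

lemma linked_arc:
  "\<lbrakk>e \<in> arcs G; persistent (tail G e); \<not> (vx (head G e) :: _ \<Rightarrow>\<^sub>0 'k::field) \<approx> 0\<rbrakk>
    \<Longrightarrow> (tail G e, head G e) \<in> linked TYPE('k)"
  by (force simp: linked_def Let_def)

lemma linked_induct [consumes 1, case_names refl forward backward]:
  assumes "(v, w) \<in> linked TYPE('k::field)"
    and refl: "Q v"
    and forward: "\<And>e. \<lbrakk>Q (tail G e); e \<in> arcs G; persistent (tail G e); \<not> (vx (head G e) :: _ \<Rightarrow>\<^sub>0 'k) \<approx> 0\<rbrakk> \<Longrightarrow> Q (head G e)"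
    and backward: "\<And>e. \<lbrakk>Q (head G e); e \<in> arcs G; persistent (tail G e); \<not> (vx (head G e) :: _ \<Rightarrow>\<^sub>0 'k) \<approx> 0\<rbrakk> \<Longrightarrow> Q (tail G e)"
  shows "Q w"
  using assms(1)[unfolded linked_def Let_def]
  by (induction rule: rtrancl_induct) (use refl forward backward in auto)

lemma linked_persistent: "\<lbrakk>(v, w) \<in> linked TYPE('k::field); persistent v\<rbrakk> \<Longrightarrow> persistent w"
  by (induction rule: linked_induct) (auto intro: persistent_head)

lemma block_persistent: "\<lbrakk>C \<in> blocks TYPE('k::field); v \<in> C\<rbrakk> \<Longrightarrow> persistent v"
  by (auto simp: blocks_def intro: linked_persistent)

lemma finite_blocks: "finite (blocks TYPE('k::field))"
proof (rule finite_subset)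
  show "blocks TYPE('k) \<subseteq> Pow (verts G)" using block_persistent persistent_verts by blast
qed auto

lemma block_nonzero: "C \<in> blocks TYPE('k::field) \<Longrightarrow> \<exists>v \<in> C. persistent v \<and> \<not> (vx v :: _ \<Rightarrow>\<^sub>0 'k) \<approx> 0"
  unfolding blocks_def using linked_refl by blast

lemma block_closed:
  assumes "C \<in> blocks TYPE('k::field)" "e \<in> arcs G" "persistent (tail G e)" "\<not> (vx (head G e) :: _ \<Rightarrow>\<^sub>0 'k) \<approx> 0"
  shows "tail G e \<in> C \<longleftrightarrow> head G e \<in> C"
proof -
  obtain v where C: "C = linked TYPE('k) `` {v}" using assms(1) by (auto simp: blocks_def)
  note arc = linked_arc[OF assms(2-4)]
  show ?thesis
    unfolding C using linked_trans[OF _ arc] linked_trans[OF _ linked_sym[OF arc]] by auto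
qed

lemma unique_block:
  assumes v: "persistent v" "\<not> (vx v :: _ \<Rightarrow>\<^sub>0 'k::field) \<approx> 0"
  shows "\<exists>!C. C \<in> blocks TYPE('k) \<and> v \<in> C"
proof (rule ex1I)
  show "linked TYPE('k) `` {v} \<in> blocks TYPE('k) \<and> v \<in> linked TYPE('k) `` {v}"
    using v linked_refl by (auto simp: blocks_def)
  fix C assume "C \<in> blocks TYPE('k) \<and> v \<in> C"
  then obtain u where C: "C = linked TYPE('k) `` {u}" and uv: "(u, v) \<in> linked TYPE('k)"
    by (auto simp: blocks_def)
  show "C = linked TYPE('k) `` {v}"
    unfolding C using linked_trans[OF uv] linked_trans[OF linked_sym[OF uv]] by auto
qed

text \<open>
  If \<open>z t = l t\<close> at the tail \<open>t\<close> of an edge \<open>e\<close>, then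
  \<open>z r(e) = z e\<^sup>* e = e\<^sup>* z t e = l r(e)\<close> at its head. So scalars propagate forwards. They also propagate
  backwards: the tail has some scalar, which agrees with that of the head because the head
  is nonzero.
\<close>

lemma central_scalar_on_block:
  fixes z :: "_ \<Rightarrow>\<^sub>0 'k::field"
  assumes z: "central z" "of_degree 0 z" and C: "C \<in> blocks TYPE('k)"
  shows "\<exists>k. \<forall>v \<in> C. z * vx v \<approx> Poly_Mapping.single [] k * vx v"
proof -
  let ?c = "\<lambda>k. Poly_Mapping.single [] k :: ('a, 'b) generator list \<Rightarrow>\<^sub>0 'k"
  note [simp] = central_polys[OF z(1)]
  obtain v where v: "persistent v" "\<not> (vx v :: _ \<Rightarrow>\<^sub>0 'k) \<approx> 0" "C = linked TYPE('k) `` {v}"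
    using C by (auto simp: blocks_def)
  obtain k where k: "z * vx v \<approx> ?c k * vx v" using central_scalar_at_persistent[OF z v(1)] by blast
  have step: "z * vx (head G e) \<approx> ?c l * vx (head G e)"
    if e [simp]: "e \<in> arcs G" and l: "z * vx (tail G e) \<approx> ?c l * vx (tail G e)" for e l
  proof -
    let ?h = "vx (head G e) :: _ \<Rightarrow>\<^sub>0 'k" and ?t = "vx (tail G e) :: _ \<Rightarrow>\<^sub>0 'k"
    let ?e = "ed e :: ('a, 'b) generator list \<Rightarrow>\<^sub>0 'k" and ?g = "gh e :: ('a, 'b) generator list \<Rightarrow>\<^sub>0 'k"
    have "?g * ?e \<approx> (if e = e then ?h else 0)" by (rule ghost_edge) auto
    then have ge: "?g * ?e \<approx> ?h" by simp
    have te: "?t * ?e \<approx> ?e" by (rule tail_edge) simp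
    have "z * ?h \<approx> z * (?g * ?e)" using cong_sym[OF ge] by (rule cong_left) simp
    also have "\<dots> = (z * ?g) * ?e" by (simp add: mult.assoc)
    also have "\<dots> \<approx> (?g * z) * ?e" by (intro cong_right central_commute[OF z(1)]) auto
    also have "\<dots> \<approx> (?g * z) * (?t * ?e)" using cong_sym[OF te] by (rule cong_left) simp
    also have "\<dots> = ?g * (z * ?t) * ?e" by (simp add: mult.assoc)
    also have "\<dots> \<approx> ?g * (?c l * ?t) * ?e" by (intro cong_right cong_left l) auto
    also have "\<dots> = (?g * ?c l) * (?t * ?e)" by (simp add: mult.assoc)
    also have "\<dots> = ?c l * (?g * (?t * ?e))" by (simp add: single_Nil_commute mult.assoc)
    also have "\<dots> \<approx> ?c l * (?g * ?e)" using te by (intro cong_left) auto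
    also have "\<dots> \<approx> ?c l * ?h" using ge by (rule cong_left) simp
    finally show ?thesis .
  qed
  have "z * vx w \<approx> ?c k * vx w" if "(v, w) \<in> linked TYPE('k)" for w
    using that
  proof (induction rule: linked_induct)
    case refl
    show ?case by (rule k)
  next
    case (forward e)
    show ?case using forward(2,1) by (rule step)
  next
    case (backward e)
    let ?h = "vx (head G e) :: _ \<Rightarrow>\<^sub>0 'k"
    obtain l where l: "z * vx (tail G e) \<approx> ?c l * vx (tail G e)"
      using central_scalar_at_persistent[OF z backward(3)] by blast
    have "l = k"
    proof (rule ccontr)
      assume "l \<noteq> k"
      have "?c l * ?h - ?c k * ?h \<approx> z * ?h - z * ?h"
        by (rule cong_diff[OF cong_sym[OF step[OF backward(2) l]] cong_sym[OF backward(1)]])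
      then have "?c (l - k) * ?h \<approx> 0" by (simp add: single_diff left_diff_distrib)
      then have "?c (inverse (l - k)) * (?c (l - k) * ?h) \<approx> 0" by - (rule cong_zero_left, auto)
      then show False using \<open>l \<noteq> k\<close> backward(4) by (simp add: mult.assoc[symmetric] single_mult_single)
    qed
    then show ?case using l by simp
  qed
  then show ?thesis using v(3) by blast
qed

end

section \<open>The degree-zero centre of a Leavitt path algebra splits\<close>

context fin_digraph
begin

definition cls :: "(('a, 'b) generator list \<Rightarrow>\<^sub>0 'k::field) \<Rightarrow> (('a, 'b) generator list \<Rightarrow>\<^sub>0 'k) set" where
  "cls f = leavitt_ideal G +>\<^bsub>free_algebra (generators G)\<^esub> f"

lemma cls_eq_iff:
  fixes f g :: "_ \<Rightarrow>\<^sub>0 'k::field"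
  assumes "f \<in> polys" "g \<in> polys"
  shows "cls f = cls g \<longleftrightarrow> f \<approx> g"
proof -
  let ?F = "free_algebra (generators G) :: (('a, 'b) generator list \<Rightarrow>\<^sub>0 'k) ring"
  interpret F: ring ?F by (rule ring_free_algebra)
  have carr: "f \<in> carrier ?F" "g \<in> carrier ?F" using assms by (simp_all add: polys_iff)
  have "\<ominus>\<^bsub>?F\<^esub> g = - g" by (rule F.minus_equality) (use assms in \<open>auto simp: polys_iff\<close>)
  then have "f \<ominus>\<^bsub>?F\<^esub> g = f - g" by (simp add: a_minus_def)
  then show ?thesis
    using F.quotient_eq_iff_same_a_r_cos[OF ideal_leavitt_ideal carr] by (simp add: cls_def leavitt_cong_def)
qed

lemma leavitt_carrier: "carrier (leavitt_path_algebra K G) = cls ` nonunital_polys"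
  by (simp add: leavitt_path_algebra_def Let_def cls_def[abs_def] leavitt_ideal_def
      nonunital_polys_def leavitt_polys_def)

lemma leavitt_homogeneous:
  "homogeneous (leavitt_path_algebra K G) n = cls ` {f \<in> nonunital_polys. of_degree n f}"
  by (simp add: leavitt_path_algebra_def Let_def cls_def[abs_def] leavitt_ideal_def
      nonunital_polys_def leavitt_polys_def of_degree_def)

lemma leavitt_one: "\<one>\<^bsub>leavitt_path_algebra K G\<^esub> = cls unit_poly"
  by (simp add: leavitt_path_algebra_def Let_def cls_def unit_poly_def leavitt_ideal_def)

lemma leavitt_zero: "\<zero>\<^bsub>leavitt_path_algebra (K :: 'k::field itself) G\<^esub> = cls 0"
proof -
  let ?F = "free_algebra (generators G) :: (('a, 'b) generator list \<Rightarrow>\<^sub>0 'k) ring"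
  interpret ideal "leavitt_ideal G" ?F by (rule ideal_leavitt_ideal)
  have "leavitt_ideal G +>\<^bsub>?F\<^esub> \<zero>\<^bsub>?F\<^esub> = leavitt_ideal G"
    using a_coset_add_zero[OF a_subset] .
  then show ?thesis
    by (simp add: leavitt_path_algebra_def Let_def cls_def leavitt_ideal_def FactRing_def)
qed

lemma leavitt_mult:
  fixes f g :: "_ \<Rightarrow>\<^sub>0 'k::field"
  assumes "f \<in> polys" "g \<in> polys"
  shows "cls f \<otimes>\<^bsub>leavitt_path_algebra TYPE('k) G\<^esub> cls g = cls (f * g)"
proof -
  let ?F = "free_algebra (generators G) :: (('a, 'b) generator list \<Rightarrow>\<^sub>0 'k) ring"
  interpret ideal "leavitt_ideal G" ?F by (rule ideal_leavitt_ideal)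
  have "[mod leavitt_ideal G:] cls f \<Otimes>\<^bsub>?F\<^esub> cls g = cls (f * g)"
    unfolding cls_def using assms rcoset_mult_add[of f g] by (simp add: polys_iff)
  then show ?thesis
    by (simp add: leavitt_path_algebra_def Let_def leavitt_ideal_def FactRing_def)
qed

lemma leavitt_add:
  fixes f g :: "_ \<Rightarrow>\<^sub>0 'k::field"
  assumes "f \<in> polys" "g \<in> polys"
  shows "cls f \<oplus>\<^bsub>leavitt_path_algebra TYPE('k) G\<^esub> cls g = cls (f + g)"
proof -
  let ?F = "free_algebra (generators G) :: (('a, 'b) generator list \<Rightarrow>\<^sub>0 'k) ring"
  interpret ideal "leavitt_ideal G" ?F by (rule ideal_leavitt_ideal)
  have "cls f <+>\<^bsub>?F\<^esub> cls g = cls (f + g)"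
    unfolding cls_def using assms a_rcos_sum[of f g] by (simp add: polys_iff)
  then show ?thesis
    by (simp add: leavitt_path_algebra_def Let_def leavitt_ideal_def FactRing_def)
qed

lemma leavitt_smult:
  fixes f :: "_ \<Rightarrow>\<^sub>0 'k::field"
  assumes "f \<in> polys"
  shows "c \<odot>\<^bsub>leavitt_path_algebra TYPE('k) G\<^esub> cls f = cls (Poly_Mapping.single [] c * f)"
  using leavitt_mult[of "Poly_Mapping.single [] c" f] assms
  by (simp add: leavitt_path_algebra_def Let_def cls_def leavitt_ideal_def)

lemma ring_leavitt_path_algebra: "ring (leavitt_path_algebra TYPE('k::field) G)"
proof (rule ringI)
  let ?L = "leavitt_path_algebra TYPE('k) G"
  note np = nonunital_polys_polys
  note [simp] = leavitt_carrier leavitt_one leavitt_zero leavitt_mult leavitt_add np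
    nonunital_mult(1)
  show "abelian_group ?L"
  proof (rule abelian_groupI)
    fix x assume "x \<in> carrier ?L"
    then obtain f :: "_ \<Rightarrow>\<^sub>0 'k" where "f \<in> nonunital_polys" "x = cls f" by auto
    then show "\<exists>y\<in>carrier ?L. y \<oplus>\<^bsub>?L\<^esub> x = \<zero>\<^bsub>?L\<^esub>"
      by (intro bexI[of _ "cls (- f)"]) auto
  qed (auto simp: algebra_simps)
  show "monoid ?L"
  proof (rule monoidI)
    fix x assume "x \<in> carrier ?L"
    then obtain f :: "_ \<Rightarrow>\<^sub>0 'k" where "f \<in> nonunital_polys" "x = cls f" by auto
    then show "\<one>\<^bsub>?L\<^esub> \<otimes>\<^bsub>?L\<^esub> x = x" "x \<otimes>\<^bsub>?L\<^esub> \<one>\<^bsub>?L\<^esub> = x"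
      by (simp_all add: cls_eq_iff unit_left unit_right)
  qed (auto simp: mult.assoc)
qed (auto simp: leavitt_carrier leavitt_mult leavitt_add nonunital_polys_polys nonunital_mult(1)
    distrib_left distrib_right)

text \<open>
  Coefficient twists and the projection onto degree zero are defined on representatives and
  descend to the algebra in this way.
\<close>

lemma lift_to_classes:
  fixes h :: "(('a, 'b) generator list \<Rightarrow>\<^sub>0 'k::field) \<Rightarrow> (('a, 'b) generator list \<Rightarrow>\<^sub>0 'k)"
  assumes closed: "\<And>f. f \<in> nonunital_polys \<Longrightarrow> h f \<in> nonunital_polys"
    and cong: "\<And>f g. \<lbrakk>f \<in> nonunital_polys; g \<in> nonunital_polys; f \<approx> g\<rbrakk> \<Longrightarrow> h f \<approx> h g"
  shows "\<exists>H. \<forall>f \<in> nonunital_polys. H (cls f) = cls (h f)"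
proof -
  define r where "r x = (SOME f. f \<in> nonunital_polys \<and> cls f = x)" for x :: "(('a, 'b) generator list \<Rightarrow>\<^sub>0 'k) set"
  have "cls (h (r (cls f))) = cls (h f)" if f: "f \<in> nonunital_polys" for f
  proof -
    have r: "r (cls f) \<in> nonunital_polys \<and> cls (r (cls f)) = cls f"
      unfolding r_def by (rule someI[of _ f]) (use f in auto)
    then have "r (cls f) \<approx> f" using f cls_eq_iff nonunital_polys_polys by blast
    then have "h (r (cls f)) \<approx> h f" using r f by (intro cong) auto
    then show ?thesis using r f closed by (simp add: cls_eq_iff nonunital_polys_polys)
  qed
  then show ?thesis by (intro exI[of _ "\<lambda>x. cls (h (r x))"]) auto
qed

lemma map_relator:
  assumes "field_automorphism \<sigma>" "r \<in> leavitt_relators G"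
  shows "Poly_Mapping.map \<sigma> r = r"
proof -
  interpret field_automorphism \<sigma> by fact
  show ?thesis
    using assms(2) unfolding leavitt_relators_def
    by (auto simp: map_var map_sum map_mult map_diff simp del: map_single)
qed

lemma map_cong:
  assumes "field_automorphism \<sigma>" "f \<approx> g"
  shows "Poly_Mapping.map \<sigma> f \<approx> Poly_Mapping.map \<sigma> g"
proof -
  interpret field_automorphism \<sigma> by fact
  have "Poly_Mapping.map \<sigma> h \<in> leavitt_ideal G" if "h \<in> leavitt_ideal G" for h
    using that
  proof (induction rule: leavitt_ideal_induct)
    case (relator r)
    then show ?case using leavitt_relators_ideal by (auto simp: map_relator[OF assms(1)])
  next
    case (left f w a)
    then show ?case by (simp add: map_mult map_single_coeff ideal_mult_left del: map_single)
  next
    case (right f w a)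
    then show ?case by (simp add: map_mult map_single_coeff ideal_mult_right del: map_single)
  qed (simp_all add: map_add ideal_add)
  then show ?thesis using assms(2) by (simp add: leavitt_cong_def map_diff[symmetric])
qed

text \<open>
  All relators are homogeneous, which is why the algebra inherits the grading of the free algebra.
\<close>

lemma relator_of_degree: "r \<in> leavitt_relators G \<Longrightarrow> \<exists>n. of_degree n (r :: _ \<Rightarrow>\<^sub>0 'k::field)"
proof -
  note degree_intros = of_degree_diff of_degree_sum of_degree_single
  assume "r \<in> leavitt_relators G"
  then show ?thesis
    unfolding leavitt_relators_def
    by (elim UnE CollectE exE conjE)
       ((rule exI[of _ 0], force simp: single_mult_single intro!: degree_intros)
        | (rule exI[of _ 1], force simp: single_mult_single intro!: degree_intros)
        | (rule exI[of _ "-1"], force simp: single_mult_single intro!: degree_intros))+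
qed

lemma degree_part_cong:
  assumes "f \<approx> g"
  shows "degree_part n f \<approx> degree_part n g"
proof -
  have "\<forall>n. degree_part n h \<in> leavitt_ideal G" if "h \<in> leavitt_ideal G" for h
    using that
  proof (induction rule: leavitt_ideal_induct)
    case (relator r)
    then obtain m where "of_degree m r" using relator_of_degree by blast
    then show ?case using relator leavitt_relators_ideal by (auto simp: degree_part_of_degree)
  qed (simp_all add: degree_part_add ideal_add degree_part_single_mult ideal_mult_left ideal_mult_right)
  then show ?thesis using assms unfolding leavitt_cong_def degree_part_diff[symmetric] by blast
qed

lemma central_eqI:
  fixes x y :: "_ \<Rightarrow>\<^sub>0 'k::field"
  assumes "central x" "central y" "x \<in> nonunital_polys" "y \<in> nonunital_polys"
    and "\<And>v. persistent v \<Longrightarrow> x * vx v \<approx> y * vx v"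
  shows "x \<approx> y"
proof -
  have "x - y \<approx> 0"
  proof (rule central_eq_zero)
    show "x - y \<in> nonunital_polys" using assms(3) nonunital_add[of x "- y"] assms(4) by simp
    show "(x - y) * vx v \<approx> 0" if "persistent v" for v
      using assms(5)[OF that] by (simp add: left_diff_distrib cong_diff_iff)
  qed (rule central_diff[OF assms(1,2)])
  then show ?thesis by (simp add: cong_diff_iff)
qed

text \<open>
  Each identity between the block idempotents \<open>x C\<close> is one between central elements, so by
  \<open>central_eqI\<close> it only has to be checked on persistent vertices, where \<open>x C\<close> is the indicator of
  \<open>C\<close>. In the same way \<open>f * x C\<close> is the scalar multiple of \<open>x C\<close> by the scalar with which a
  central \<open>f\<close> of degree zero acts on \<open>C\<close>.
\<close>

lemma split_graded_leavitt_path_algebra: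
  "\<exists>(S :: 'a set set) e p. split_graded_algebra (leavitt_path_algebra TYPE('k::field) G) S e p"
proof -
  let ?L = "leavitt_path_algebra TYPE('k) G"
  let ?S = "blocks TYPE('k)"
  let ?c = "\<lambda>k. Poly_Mapping.single [] k :: ('a, 'b) generator list \<Rightarrow>\<^sub>0 'k"
  let ?v = "vx :: _ \<Rightarrow> _ \<Rightarrow>\<^sub>0 'k"
  let ?u = "unit_poly :: _ \<Rightarrow>\<^sub>0 'k"
  interpret L: ring ?L by (rule ring_leavitt_path_algebra)
  note np = nonunital_polys_polys
  note [simp] = leavitt_one leavitt_zero leavitt_mult leavitt_add leavitt_smult np
    nonunital_mult
  have "\<exists>x :: _ \<Rightarrow>\<^sub>0 'k. x \<in> nonunital_polys \<and> of_degree 0 x \<and> central x \<and>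
    (\<forall>\<sigma>. field_automorphism \<sigma> \<longrightarrow> Poly_Mapping.map \<sigma> x = x) \<and>
    (\<forall>v. persistent v \<longrightarrow> x * vx v \<approx> (if v \<in> C then vx v else 0))" if "C \<in> ?S" for C
    by (rule block_idempotent_exists) (rule block_closed[OF that])
  then have "\<forall>C \<in> ?S. \<exists>x :: _ \<Rightarrow>\<^sub>0 'k. x \<in> nonunital_polys \<and> of_degree 0 x \<and> central x \<and>
    (\<forall>\<sigma>. field_automorphism \<sigma> \<longrightarrow> Poly_Mapping.map \<sigma> x = x) \<and>
    (\<forall>v. persistent v \<longrightarrow> x * vx v \<approx> (if v \<in> C then vx v else 0))"
    by blast
  from bchoice[OF this] obtain x :: "'a set \<Rightarrow> ('a, 'b) generator list \<Rightarrow>\<^sub>0 'k" where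
    x: "\<forall>C \<in> ?S. x C \<in> nonunital_polys \<and> of_degree 0 (x C) \<and> central (x C) \<and>
    (\<forall>\<sigma>. field_automorphism \<sigma> \<longrightarrow> Poly_Mapping.map \<sigma> (x C) = x C) \<and>
    (\<forall>v. persistent v \<longrightarrow> x C * vx v \<approx> (if v \<in> C then vx v else 0))" ..
  have x_nu [simp]: "x C \<in> nonunital_polys" and x_deg: "of_degree 0 (x C)"
    and x_central: "central (x C)" if "C \<in> ?S" for C
    using x that by blast+
  have x_map: "Poly_Mapping.map \<sigma> (x C) = x C" if "C \<in> ?S" "field_automorphism \<sigma>" for C \<sigma>
    using x that by blast
  have x_vertex: "x C * vx v \<approx> (if v \<in> C then vx v else 0)" if "C \<in> ?S" "persistent v" for C v
    using x that by blast
  have x_scaled: "y * x C \<approx> y' * x C"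
    if C: "C \<in> ?S" and y: "central y" "central y'" and eq: "\<And>v. v \<in> C \<Longrightarrow> y * ?v v \<approx> y' * ?v v" for y y' C
  proof (rule central_eqI)
    note [simp] = y[THEN central_polys]
    fix v assume v: "persistent v"
    have "y * x C * vx v \<approx> y * (if v \<in> C then vx v else 0)"
      unfolding mult.assoc using x_vertex[OF C v] by (rule cong_left) simp
    also have "\<dots> \<approx> y' * (if v \<in> C then vx v else 0)" using eq by auto
    also have "\<dots> \<approx> y' * (x C * vx v)" using cong_sym[OF x_vertex[OF C v]] by (rule cong_left) simp
    finally show "y * x C * vx v \<approx> y' * x C * vx v" by (simp add: mult.assoc)
  next
    show "central (y * x C)" "central (y' * x C)" by (intro central_mult y x_central[OF C])+
    show "y * x C \<in> nonunital_polys" "y' * x C \<in> nonunital_polys"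
      by (intro nonunital_mult(2) central_polys y x_nu[OF C])+
  qed
  have x_mult: "x C * x D \<approx> (if C = D then x C else 0)" if CD: "C \<in> ?S" "D \<in> ?S" for C D
  proof -
    have "x C * x D \<approx> (if C = D then 1 else 0) * x D"
    proof (rule x_scaled[OF CD(2) x_central[OF CD(1)]])
      show "central (if C = D then 1 else 0 :: _ \<Rightarrow>\<^sub>0 'k)" by (simp add: central_def)
      fix v assume v: "v \<in> D"
      have vp: "persistent v" by (rule block_persistent[OF CD(2) v])
      note x_vertex[OF CD(1) vp]
      also have "(if v \<in> C then ?v v else 0) \<approx> (if C = D then 1 else 0) * ?v v"
        \<comment> \<open>Only a vertex that does not vanish determines its block.\<close>
      proof (cases "?v v \<approx> 0")
        case True
        then have "(if b then ?v v else 0) \<approx> 0" "(if b then 1 else 0) * ?v v \<approx> 0" for b by auto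
        then show ?thesis using cong_trans[OF _ cong_sym] by blast
      next
        case False
        then have "v \<in> C \<longleftrightarrow> C = D" using unique_block[OF vp False] CD v by blast
        then show ?thesis by simp
      qed
      finally show "x C * vx v \<approx> (if C = D then 1 else 0) * ?v v" .
    qed
    then show ?thesis by (auto split: if_splits)
  qed
  have x_sum: "(\<Sum>C\<in>?S. x C) \<approx> ?u"
  proof (rule central_eqI)
    fix v assume v: "persistent v"
    have vu: "?u * ?v v \<approx> ?v v" using persistent_verts[OF v] by (intro unit_left) simp
    have eq: "(\<Sum>C\<in>?S. x C) * ?v v \<approx> (\<Sum>C\<in>?S. if v \<in> C then ?v v else 0)"
      unfolding sum_distrib_right by (intro cong_sum x_vertex v)
    show "(\<Sum>C\<in>?S. x C) * ?v v \<approx> ?u * ?v v"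
    proof (cases "?v v \<approx> 0")
      case True
      then have zero: "y * ?v v \<approx> 0" if "y \<in> polys" for y using that by (rule cong_zero_left)
      show ?thesis by (rule cong_trans[OF zero cong_sym[OF zero]]) auto
    next
      case False
      obtain D where D: "D \<in> ?S" "v \<in> D" "\<And>C. \<lbrakk>C \<in> ?S; v \<in> C\<rbrakk> \<Longrightarrow> C = D"
        using unique_block[OF v False] by blast
      have "(\<Sum>C\<in>?S. if v \<in> C then ?v v else 0) = (\<Sum>C\<in>?S. if C = D then ?v v else 0)"
      proof (rule sum.cong)
        fix C assume "C \<in> ?S"
        then have "v \<in> C \<longleftrightarrow> C = D" using D by blast
        then show "(if v \<in> C then ?v v else 0) = (if C = D then ?v v else 0)" by simp
      qed simp
      also have "\<dots> = ?v v" using D(1) by (simp add: sum.delta[OF finite_blocks])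
      finally have "(\<Sum>C\<in>?S. if v \<in> C then ?v v else 0) = ?v v" .
      from cong_trans[OF eq[unfolded this] cong_sym[OF vu]] show ?thesis .
    qed
  next
    show "central (\<Sum>C\<in>?S. x C)" by (rule central_sum) (rule x_central)
    show "(\<Sum>C\<in>?S. x C) \<in> nonunital_polys" by (rule nonunital_sum) (rule x_nu)
  qed (simp_all add: central_unit_poly)
  have central_cls: "cls f \<in> degree_zero_center ?L" if "f \<in> nonunital_polys" "of_degree 0 f" "central f" for f :: "_ \<Rightarrow>\<^sub>0 'k"
    using that by (auto simp: degree_zero_center_def leavitt_homogeneous leavitt_carrier cls_eq_iff central_commute)
  have degree_part_nu [simp]: "degree_part n f \<in> nonunital_polys" if "f \<in> nonunital_polys" for n and f :: "_ \<Rightarrow>\<^sub>0 'k"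
    using that keys_degree_part[of n f] by (auto simp: nonunital_polys_iff)
  obtain p where p: "\<And>f :: _ \<Rightarrow>\<^sub>0 'k. f \<in> nonunital_polys \<Longrightarrow> p (cls f) = cls (degree_part 0 f)"
  proof -
    have "\<exists>H. \<forall>f :: _ \<Rightarrow>\<^sub>0 'k \<in> nonunital_polys. H (cls f) = cls (degree_part 0 f)"
    proof (rule lift_to_classes)
      show "degree_part 0 f \<in> nonunital_polys" if "f \<in> nonunital_polys" for f :: "_ \<Rightarrow>\<^sub>0 'k"
        using that by (rule degree_part_nu)
    qed (rule degree_part_cong)
    then show ?thesis using that by blast
  qed
  have scalar: "c \<odot>\<^bsub>?L\<^esub> \<one>\<^bsub>?L\<^esub> = cls (?c c * ?u)" for c by simp
  have "split_graded_algebra ?L ?S (\<lambda>C. cls (x C)) p"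
  proof (unfold_locales)
    show "homogeneous ?L n \<subseteq> carrier ?L" for n
      by (auto simp: leavitt_carrier leavitt_homogeneous)
    show "a \<otimes>\<^bsub>?L\<^esub> b \<in> homogeneous ?L n" if "a \<in> homogeneous ?L 0" "b \<in> homogeneous ?L n" for a b n
      using that of_degree_mult[of 0 _ n] by (fastforce simp: leavitt_homogeneous)
    show "c \<odot>\<^bsub>?L\<^esub> a = (c \<odot>\<^bsub>?L\<^esub> \<one>\<^bsub>?L\<^esub>) \<otimes>\<^bsub>?L\<^esub> a" if a: "a \<in> carrier ?L" for a c
    proof -
      obtain f :: "_ \<Rightarrow>\<^sub>0 'k" where f: "f \<in> nonunital_polys" "a = cls f" using a by (auto simp: leavitt_carrier)
      have "?c c * f \<approx> ?c c * (?u * f)" using f by (intro cong_left cong_sym[OF unit_left]) auto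
      then show ?thesis using f by (simp add: cls_eq_iff mult.assoc)
    qed
    show "c \<odot>\<^bsub>?L\<^esub> \<one>\<^bsub>?L\<^esub> \<in> degree_zero_center ?L" for c
      unfolding scalar
    proof (rule central_cls)
      have "of_degree 0 ?u" by (simp add: unit_poly_def of_degree_sum of_degree_single)
      then show "of_degree 0 (?c c * ?u)" using of_degree_mult[of 0 "?c c" 0 ?u] by (simp add: of_degree_single)
      show "central (?c c * ?u)" by (intro central_mult central_scalar central_unit_poly)
    qed simp
    show "1 \<odot>\<^bsub>?L\<^esub> \<one>\<^bsub>?L\<^esub> = \<one>\<^bsub>?L\<^esub>" by simp
    show "(c + d) \<odot>\<^bsub>?L\<^esub> \<one>\<^bsub>?L\<^esub> = c \<odot>\<^bsub>?L\<^esub> \<one>\<^bsub>?L\<^esub> \<oplus>\<^bsub>?L\<^esub> d \<odot>\<^bsub>?L\<^esub> \<one>\<^bsub>?L\<^esub>" for c d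
      by (simp add: single_add distrib_right)
    show "(c * d) \<odot>\<^bsub>?L\<^esub> \<one>\<^bsub>?L\<^esub> = (c \<odot>\<^bsub>?L\<^esub> \<one>\<^bsub>?L\<^esub>) \<otimes>\<^bsub>?L\<^esub> (d \<odot>\<^bsub>?L\<^esub> \<one>\<^bsub>?L\<^esub>)" for c d
    proof -
      have "?c (c * d) * ?u = ?c c * (?c d * ?u)" by (simp add: mult.assoc[symmetric] single_mult_single)
      also have "\<dots> \<approx> ?c c * (?u * (?c d * ?u))" by (intro cong_left cong_sym[OF unit_left]) auto
      finally show ?thesis by (simp add: cls_eq_iff mult.assoc)
    qed
    show "p a \<in> homogeneous ?L 0" if "a \<in> carrier ?L" for a
      using that by (auto simp: leavitt_carrier leavitt_homogeneous p of_degree_part)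
    show "p (a \<oplus>\<^bsub>?L\<^esub> b) = p a \<oplus>\<^bsub>?L\<^esub> p b" if "a \<in> carrier ?L" "b \<in> carrier ?L" for a b
      using that by (auto simp: leavitt_carrier p degree_part_add)
    show "p a = (if n = 0 then a else \<zero>\<^bsub>?L\<^esub>)" if "a \<in> homogeneous ?L n" for a n
      using that by (auto simp: leavitt_homogeneous p degree_part_of_degree)
    show "Q a" if a: "a \<in> carrier ?L" and hom: "\<And>n a. a \<in> homogeneous ?L n \<Longrightarrow> Q a"
      and add: "\<And>a b. \<lbrakk>a \<in> carrier ?L; b \<in> carrier ?L; Q a; Q b\<rbrakk> \<Longrightarrow> Q (a \<oplus>\<^bsub>?L\<^esub> b)" for Q a
    proof -
      obtain f :: "_ \<Rightarrow>\<^sub>0 'k" where f: "f \<in> nonunital_polys" "a = cls f" using a by (auto simp: leavitt_carrier)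
      have "Q (cls f)"
        using f(1)[unfolded nonunital_polys_iff]
      proof (induction f rule: poly_mapping_monomial_induct)
        case zero
        show ?case by (rule hom[of _ 0]) (auto simp: leavitt_homogeneous)
      next
        case (monomial w a)
        then have "Poly_Mapping.single w a \<in> nonunital_polys"
          by (auto simp: nonunital_polys_iff split: if_splits)
        then show ?case
          by (intro hom[of _ "word_degree w"]) (auto simp: leavitt_homogeneous intro!: imageI of_degree_single)
      next
        case (add f g)
        then have fg: "f \<in> nonunital_polys" "g \<in> nonunital_polys" by (simp_all add: nonunital_polys_iff)
        have "Q (cls f \<oplus>\<^bsub>?L\<^esub> cls g)" by (rule that(3)) (use add fg in \<open>auto simp: leavitt_carrier\<close>)
        then show ?case using fg by simp
      qed
      then show ?thesis using f by simp
    qed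
    show "cls (x C) \<in> degree_zero_center ?L" if "C \<in> ?S" for C
      using that by (intro central_cls x_deg x_central x_nu)
    show "cls (x C) \<noteq> \<zero>\<^bsub>?L\<^esub>" if C: "C \<in> ?S" for C
    proof
      assume "cls (x C) = \<zero>\<^bsub>?L\<^esub>"
      then have x0: "x C \<approx> 0" using C by (simp add: cls_eq_iff)
      obtain v where v: "v \<in> C" "persistent v" "\<not> ?v v \<approx> 0" using block_nonzero[OF C] by blast
      have "?v v \<approx> x C * ?v v" using cong_sym[OF x_vertex[OF C v(2)]] v(1) by simp
      also have "\<dots> \<approx> 0" using x0 persistent_verts[OF v(2)] by - (rule cong_zero_right, auto)
      finally show False using v(3) by blast
    qed
    show "cls (x C) \<otimes>\<^bsub>?L\<^esub> cls (x C) = cls (x C)" if C: "C \<in> ?S" for C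
      using C x_mult[OF C C] by (simp add: cls_eq_iff)
    show "a = \<zero>\<^bsub>?L\<^esub>" if a: "a \<in> carrier ?L" and zero: "\<And>C. C \<in> ?S \<Longrightarrow> cls (x C) \<otimes>\<^bsub>?L\<^esub> a = \<zero>\<^bsub>?L\<^esub>" for a
    proof -
      obtain f :: "_ \<Rightarrow>\<^sub>0 'k" where f: "f \<in> nonunital_polys" "a = cls f" using a by (auto simp: leavitt_carrier)
      have xf: "x C * f \<approx> 0" if "C \<in> ?S" for C using zero[OF that] f that by (simp add: cls_eq_iff)
      have "f \<approx> ?u * f" using f by (intro cong_sym[OF unit_left])
      also have "\<dots> \<approx> (\<Sum>C\<in>?S. x C) * f" using f by (intro cong_right cong_sym[OF x_sum]) auto
      also have "\<dots> = (\<Sum>C\<in>?S. x C * f)" by (simp add: sum_distrib_right)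
      also have "\<dots> \<approx> (\<Sum>C\<in>?S. 0)" by (intro cong_sum xf)
      finally show ?thesis using f by (simp add: cls_eq_iff)
    qed
    show "\<exists>y\<in>carrier ?L. (\<forall>C\<in>?S. cls (x C) \<otimes>\<^bsub>?L\<^esub> y = cls (x C) \<otimes>\<^bsub>?L\<^esub> g C) \<and>
        (\<forall>n. (\<forall>C\<in>?S. g C \<in> homogeneous ?L n) \<longrightarrow> y \<in> homogeneous ?L n)"
      if g: "\<And>C. C \<in> ?S \<Longrightarrow> g C \<in> carrier ?L" for g
    proof -
      have "\<forall>C \<in> ?S. \<exists>f :: _ \<Rightarrow>\<^sub>0 'k. f \<in> nonunital_polys \<and> g C = cls f" using g by (auto simp: leavitt_carrier)
      then obtain f :: "'a set \<Rightarrow> _ \<Rightarrow>\<^sub>0 'k" where f [simp]: "\<And>C. C \<in> ?S \<Longrightarrow> f C \<in> nonunital_polys"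
          "\<And>C. C \<in> ?S \<Longrightarrow> g C = cls (f C)"
        by metis
      let ?y = "\<Sum>C\<in>?S. x C * f C"
      have y [simp]: "?y \<in> nonunital_polys" by simp
      have "x C * ?y \<approx> x C * f C" if C: "C \<in> ?S" for C
      proof -
        have "x C * ?y \<approx> (\<Sum>D\<in>?S. if D = C then x C * f C else 0)"
          unfolding sum_distrib_left
        proof (rule cong_sum)
          fix D assume D: "D \<in> ?S"
          have "x C * (x D * f D) \<approx> (if C = D then x C else 0) * f D"
            unfolding mult.assoc[symmetric] using D by (intro cong_right x_mult[OF C D]) simp
          then show "x C * (x D * f D) \<approx> (if D = C then x C * f C else 0)" by (auto split: if_splits)
        qed
        then show ?thesis using C by (simp add: sum.delta[OF finite_blocks])
      qed
      moreover have "cls ?y \<in> homogeneous ?L n" if hom: "\<forall>C\<in>?S. g C \<in> homogeneous ?L n" for n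
      proof -
        \<comment> \<open>A homogeneous class has some homogeneous representative, but \<open>f C\<close> was chosen before \<open>n\<close>.\<close>
        have "\<forall>C \<in> ?S. \<exists>h :: _ \<Rightarrow>\<^sub>0 'k. h \<in> nonunital_polys \<and> of_degree n h \<and> g C = cls h"
          using hom by (auto simp: leavitt_homogeneous)
        then obtain h :: "'a set \<Rightarrow> _ \<Rightarrow>\<^sub>0 'k" where h: "\<And>C. C \<in> ?S \<Longrightarrow> h C \<in> nonunital_polys"
            "\<And>C. C \<in> ?S \<Longrightarrow> of_degree n (h C)" "\<And>C. C \<in> ?S \<Longrightarrow> g C = cls (h C)"
          by metis
        have "?y \<approx> (\<Sum>C\<in>?S. x C * h C)"
        proof (intro cong_sum cong_left)
          fix C assume C: "C \<in> ?S"
          have "cls (f C) = cls (h C)" using f(2)[OF C] h(3)[OF C] by (rule trans[OF sym])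
          then show "f C \<approx> h C" using C h(1) f(1) cls_eq_iff np by blast
        qed auto
        moreover have "of_degree n (\<Sum>C\<in>?S. x C * h C)"
          using of_degree_mult[OF x_deg h(2)] by (auto intro: of_degree_sum)
        moreover have "(\<Sum>C\<in>?S. x C * h C) \<in> nonunital_polys" using h(1) by simp
        ultimately show ?thesis unfolding leavitt_homogeneous by (metis (mono_tags, lifting) cls_eq_iff imageI mem_Collect_eq np y)
      qed
      ultimately show ?thesis
        by (intro bexI[of _ "cls ?y"]) (auto simp: cls_eq_iff leavitt_carrier)
    qed
    show "\<exists>k. z \<otimes>\<^bsub>?L\<^esub> cls (x C) = k \<odot>\<^bsub>?L\<^esub> cls (x C)" if z: "z \<in> degree_zero_center ?L" and C: "C \<in> ?S" for z C
    proof -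
      obtain f :: "_ \<Rightarrow>\<^sub>0 'k" where f: "f \<in> nonunital_polys" "of_degree 0 f" "z = cls f"
        using z by (auto simp: degree_zero_center_def leavitt_homogeneous)
      have "f * var g \<approx> var g * f" if "g \<in> generators G" for g
      proof -
        have "cls (var g) \<in> carrier ?L" using that by (auto simp: leavitt_carrier)
        then have "cls f \<otimes>\<^bsub>?L\<^esub> cls (var g) = cls (var g) \<otimes>\<^bsub>?L\<^esub> cls f"
          using z f by (auto simp: degree_zero_center_def)
        then show ?thesis using f that by (simp add: cls_eq_iff)
      qed
      then have central: "central f" using f by (simp add: central_def)
      obtain k where k: "\<And>v. v \<in> C \<Longrightarrow> f * ?v v \<approx> ?c k * ?v v"
        using central_scalar_on_block[OF central f(2) C] by blast
      have "f * x C \<approx> ?c k * x C"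
        by (rule x_scaled[OF C central central_scalar k])
      then show ?thesis using f C by (intro exI[of _ k]) (simp add: cls_eq_iff)
    qed
    show "\<exists>T \<in> graded_ring_iso ?L ?L. (\<forall>c. T (c \<odot>\<^bsub>?L\<^esub> \<one>\<^bsub>?L\<^esub>) = \<sigma> c \<odot>\<^bsub>?L\<^esub> \<one>\<^bsub>?L\<^esub>) \<and>
        (\<forall>C \<in> ?S. T (cls (x C)) = cls (x C))"
      if \<sigma>: "field_automorphism \<sigma>" for \<sigma>
    proof -
      interpret \<sigma>: field_automorphism \<sigma> by fact
      interpret inverse: field_automorphism "inv_into UNIV \<sigma>" by (rule \<sigma>.inverse_automorphism)
      have map_nu [simp]: "Poly_Mapping.map \<tau> f \<in> nonunital_polys \<longleftrightarrow> f \<in> nonunital_polys"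
        if "field_automorphism \<tau>" for \<tau> and f :: "_ \<Rightarrow>\<^sub>0 'k"
        by (simp add: nonunital_polys_iff field_automorphism.keys_map[OF that])
      have "\<exists>H. \<forall>f :: _ \<Rightarrow>\<^sub>0 'k \<in> nonunital_polys. H (cls f) = cls (Poly_Mapping.map \<tau> f)"
        if "field_automorphism \<tau>" for \<tau>
      proof (rule lift_to_classes)
        show "Poly_Mapping.map \<tau> f \<in> nonunital_polys" if "f \<in> nonunital_polys" for f :: "_ \<Rightarrow>\<^sub>0 'k"
          using map_nu[OF \<open>field_automorphism \<tau>\<close>] that by blast
      qed (rule map_cong[OF that])
      note lift = this
      obtain T where "\<forall>f :: _ \<Rightarrow>\<^sub>0 'k \<in> nonunital_polys. T (cls f) = cls (Poly_Mapping.map \<sigma> f)"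
        using lift[OF \<sigma>] ..
      note T = bspec[OF this]
      obtain T' where "\<forall>f :: _ \<Rightarrow>\<^sub>0 'k \<in> nonunital_polys. T' (cls f) = cls (Poly_Mapping.map (inv_into UNIV \<sigma>) f)"
        using lift[OF \<sigma>.inverse_automorphism] ..
      note T' = bspec[OF this]
      have map_u: "Poly_Mapping.map \<sigma> ?u = ?u"
        by (simp add: unit_poly_def \<sigma>.map_sum \<sigma>.map_var del: map_single)
      have "T \<in> ring_hom ?L ?L"
        by (rule ring_hom_memI)
           (auto simp: leavitt_carrier T \<sigma> map_u \<sigma>.map_add \<sigma>.map_mult)
      moreover have "bij_betw T (carrier ?L) (carrier ?L)"
        by (rule bij_betw_byWitness[of _ T'])
           (auto simp: leavitt_carrier T T' \<sigma> \<sigma>.inverse_automorphism map_inverse_automorphism)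
      moreover have "T ` homogeneous ?L n \<subseteq> homogeneous ?L n" for n
        by (auto simp: leavitt_homogeneous T \<sigma> of_degree_def \<sigma>.keys_map intro!: imageI)
      moreover have "T (c \<odot>\<^bsub>?L\<^esub> \<one>\<^bsub>?L\<^esub>) = \<sigma> c \<odot>\<^bsub>?L\<^esub> \<one>\<^bsub>?L\<^esub>" for c
        by (simp add: T \<sigma>.map_mult map_u \<sigma>.map_single_coeff del: map_single)
      moreover have "T (cls (x C)) = cls (x C)" if "C \<in> ?S" for C
        using that \<sigma> by (simp add: T x_map)
      ultimately show ?thesis
        by (intro bexI[of _ T]) (auto simp: graded_ring_iso_def ring_iso_def)
    qed
  qed
  then show ?thesis by blast
qed

end

theorem corollary4p9:
  fixes E :: "('v, 'e) pre_digraph" and F :: "('w, 'f) pre_digraph"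
  assumes "polycephaly_graph E" and "polycephaly_graph F"
  shows "graded_ring_isomorphic (leavitt_path_algebra TYPE('k::field) E)
             (leavitt_path_algebra TYPE('k) F) \<longleftrightarrow>
         graded_algebra_isomorphic (leavitt_path_algebra TYPE('k) E)
             (leavitt_path_algebra TYPE('k) F)"
proof
  interpret E: fin_digraph E using assms(1) by (simp add: polycephaly_graph_def)
  interpret F: fin_digraph F using assms(2) by (simp add: polycephaly_graph_def)
  assume iso: "graded_ring_isomorphic (leavitt_path_algebra TYPE('k) E) (leavitt_path_algebra TYPE('k) F)"
  obtain S e p where "split_graded_algebra (leavitt_path_algebra TYPE('k) E) (S :: 'v set set) e p"
    using E.split_graded_leavitt_path_algebra by blast
  moreover obtain S' e' p' where "split_graded_algebra (leavitt_path_algebra TYPE('k) F) (S' :: 'w set set) e' p'"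
    using F.split_graded_leavitt_path_algebra by blast
  ultimately show "graded_algebra_isomorphic (leavitt_path_algebra TYPE('k) E) (leavitt_path_algebra TYPE('k) F)"
    using iso by (rule graded_ring_isomorphic_imp_algebra)
next
  assume "graded_algebra_isomorphic (leavitt_path_algebra TYPE('k) E) (leavitt_path_algebra TYPE('k) F)"
  then show "graded_ring_isomorphic (leavitt_path_algebra TYPE('k) E) (leavitt_path_algebra TYPE('k) F)"
    by (auto simp: graded_algebra_isomorphic_def graded_ring_isomorphic_def graded_algebra_iso_def)
qed

end
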